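(* Let $A \subset \mathbb{N}$ be a TE set. Then for any $B \subset \mathbb{N}$ of positive upper density and any non-constant polynomial $p(n) \in \mathbb{Z}[n]$ with a positive leading coefficient we have $$(A+B) \cap \{p(n) \mid n \in \mathbb{N}\} \neq \emptyset.$$ Moreover, if the density of $B$ exists and is positive, then the set $R_p = \{ n \in \mathbb{N} \mid p(n) \in A+B\}$ is syndetic (it has bounded gaps).
   Context: $A+B=\{a+b \mid a\in A, b\in B\}$. For $S\subset\mathbb{N}$, the density is $d(S)=\lim_{N\to\infty}\frac1N\sum_{n=1}^N 1_S(n)$ when this limit exists; the upper density $\overline{d}(S)$ is the corresponding limsup. A measure preserving system $(X,\mathbb{B},\mu,T)$ consists of a compact metric space $X$, its Borel $\sigma$-algebra $\mathbb{B}$, a continuous map $T:X\to X$, and a probability measure $\mu$ on $\mathbb{B}$ with $\mu(T^{-1}B)=\mu(B)$ for all $B\in\mathbb{B}$. It is ergodic if every $B\in\mathbb{B}$ with $T^{-1}B=B$ has measure $0$ or $1$; it is totally ergodic if $(X,\mathbb{B},\mu,T^n)$ is ergodic for every $n\in\mathbb{N}$. A point $\xi\in X$ is generic if $\lim_{N\to\infty}\frac1N\sum_{n=0}^{N-1} f(T^n\xi)=\int_X f\,d\mu$ for every continuous $f$ on $X$. For $S\subset\mathbb{N}$, regard $\xi=1_S$ as a point of $\Omega=\{0,1\}^{\mathbb{N}}$ (product topology) with the shift $(T\omega)_n=\omega_{n+1}$, and let $X_\xi\subset\Omega$ be the closure of the forward orbit of $\xi$ under $T$. The set $S$ is a TE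 set if there is a measure $\mu$ such that $\xi=1_S$ is a generic point of the measure preserving system $(X_\xi,\mathbb{B},\mu,T)$, this system is totally ergodic, and the density $d(S)$ (which then exists) is positive. *)

theory Defs
  imports
    "HOL-Probability.Probability_Measure"
    "HOL-Computational_Algebra.Polynomial"
    "HOL-Library.Set_Algebras"
begin

text \<open>
  The natural numbers here start at 1, so sets of natural numbers are \<^typ>\<open>nat set\<close>s contained in
  \<open>{1..}\<close>. The sumset is the \<open>+\<close> on sets of \<open>Set_Algebras\<close>.
\<close>

subsection \<open>Densities and syndetic sets\<close>

definition density_avg :: "nat set \<Rightarrow> nat \<Rightarrow> real" where
  "density_avg S N = (\<Sum>n=1..N. indicator S n) / real N"

definition has_density :: "nat set \<Rightarrow> real \<Rightarrow> bool" where
  "has_density S d \<longleftrightarrow> density_avg S \<longlonglongrightarrow> d"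

definition upper_density :: "nat set \<Rightarrow> ereal" where
  "upper_density S = limsup (\<lambda>N. ereal (density_avg S N))"

definition syndetic :: "nat set \<Rightarrow> bool" where
  "syndetic S \<longleftrightarrow> (\<exists>L. \<forall>n\<ge>1. \<exists>m\<in>S. n \<le> m \<and> m \<le> n + L)"

subsection \<open>Measure preserving systems\<close>

text \<open>
  The phase space \<open>X\<close> is a subset of an ambient type; the map \<open>T\<close> lives on the ambient type, but only
  its restriction to \<open>X\<close> matters. No particular metric is fixed, only metrizability of \<open>X\<close>.
\<close>

definition measure_preserving_system ::
  "'a::topological_space set \<Rightarrow> 'a measure \<Rightarrow> ('a \<Rightarrow> 'a) \<Rightarrow> bool" where
  "measure_preserving_system X \<mu> T \<longleftrightarrow>
     compact X \<and> metrizable_space (top_of_set X) \<and>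
     continuous_on X T \<and> T \<in> X \<rightarrow> X \<and>
     space \<mu> = X \<and> sets \<mu> = sets (restrict_space borel X) \<and> prob_space \<mu> \<and>
     (\<forall>B\<in>sets \<mu>. measure \<mu> (T -` B \<inter> X) = measure \<mu> B)"

definition ergodic_system ::
  "'a::topological_space set \<Rightarrow> 'a measure \<Rightarrow> ('a \<Rightarrow> 'a) \<Rightarrow> bool" where
  "ergodic_system X \<mu> T \<longleftrightarrow>
     measure_preserving_system X \<mu> T \<and>
     (\<forall>B\<in>sets \<mu>. T -` B \<inter> X = B \<longrightarrow> measure \<mu> B = 0 \<or> measure \<mu> B = 1)"

definition totally_ergodic_system ::
  "'a::topological_space set \<Rightarrow> 'a measure \<Rightarrow> ('a \<Rightarrow> 'a) \<Rightarrow> bool" where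
  "totally_ergodic_system X \<mu> T \<longleftrightarrow>
     measure_preserving_system X \<mu> T \<and> (\<forall>n\<ge>1. ergodic_system X \<mu> (T ^^ n))"

definition generic_point ::
  "'a::topological_space set \<Rightarrow> 'a measure \<Rightarrow> ('a \<Rightarrow> 'a) \<Rightarrow> 'a \<Rightarrow> bool" where
  "generic_point X \<mu> T \<xi> \<longleftrightarrow>
     \<xi> \<in> X \<and>
     (\<forall>f::'a \<Rightarrow> real. continuous_on X f \<longrightarrow>
        (\<lambda>N. (\<Sum>n<N. f ((T ^^ n) \<xi>)) / real N) \<longlonglongrightarrow> (\<integral>x. f x \<partial>\<mu>))"

subsection \<open>TE sets\<close>

text \<open>
  The space of 0-1 sequences is \<^typ>\<open>nat \<Rightarrow> bool\<close> with its product topology (\<^typ>\<open>bool\<close> being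
  discrete). Sequences are indexed by \<open>1, 2, 3, \<dots>\<close>, so position \<open>k\<close> of the function holds the
  coordinate with index \<open>Suc k\<close>.
\<close>

definition indicator_seq :: "nat set \<Rightarrow> nat \<Rightarrow> bool" where
  "indicator_seq S = (\<lambda>k. Suc k \<in> S)"

definition shift :: "(nat \<Rightarrow> bool) \<Rightarrow> nat \<Rightarrow> bool" where
  "shift \<omega> = (\<lambda>n. \<omega> (Suc n))"

definition orbit_closure :: "(nat \<Rightarrow> bool) \<Rightarrow> (nat \<Rightarrow> bool) set" where
  "orbit_closure \<xi> = closure (range (\<lambda>n. (shift ^^ n) \<xi>))"

definition TE_set :: "nat set \<Rightarrow> bool" where
  "TE_set S \<longleftrightarrow>
     (\<exists>\<mu>. measure_preserving_system (orbit_closure (indicator_seq S)) \<mu> shift \<and>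
          generic_point (orbit_closure (indicator_seq S)) \<mu> shift (indicator_seq S) \<and>
          totally_ergodic_system (orbit_closure (indicator_seq S)) \<mu> shift) \<and>
     (\<exists>d>0. has_density S d)"

end

theory Submission
  imports Defs
begin

text \<open>
  Put \<open>g = 1\<^sub>A - d(A)\<close> on the positive integers. Suppose that \<open>p(n) \<notin> A + B\<close> for all \<open>n\<close> in a window
  of length \<open>N\<close> on which \<open>M < p(n) \<le> 2M\<close>. Then \<open>g(p(n) - b) = -d(A)\<close> for all \<open>b \<in> B \<inter> [1,M]\<close> and all
  \<open>n\<close> in the window, so \<open>\<Sum>\<^sub>x (\<Sum>\<^sub>n g(x + p(n)))\<^sup>2\<close> is at least \<open>d(A)\<^sup>2 N\<^sup>2 |B \<inter> [1,M]|\<close>. On the other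
  hand, with \<open>g\<close> truncated to \<open>[1,L]\<close>, that sum is at most \<open>\<epsilon> L N\<^sup>2\<close> for large \<open>N\<close> and \<open>L\<close>, uniformly
  in the position of the window. This is proved by induction on \<open>deg p\<close>: van der Corput's
  inequality, followed by a change of variables in \<open>x\<close> and Cauchy--Schwarz, passes from \<open>p\<close> to the
  differences \<open>p(n + h) - p(n)\<close>, for a bounded number of \<open>h\<close>. For linear \<open>p\<close> with slope \<open>t\<close> the bound
  follows from the mean ergodic theorem for \<open>T\<^sup>t\<close>, transferred to \<open>g\<close> at the generic point \<open>1\<^sub>A\<close>; this
  is where total ergodicity enters. The window length \<open>N\<close> is bounded, whence syndeticity.
\<close>

subsection \<open>Van der Corput's inequality for polynomial sequences\<close>

text \<open>Shifting the window by \<open>j < H\<close> changes the sum only in the end blocks, so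
  \<open>H\<close> times the sum is close to the sum of all short block sums; Cauchy-Schwarz then
  bounds both parts. The end terms stay as sums of squares so that they can be summed over
  translates.\<close>

lemma van_der_corput:
  fixes u :: "nat \<Rightarrow> real"
  assumes "H \<ge> 1"
  shows "(\<Sum>n=a..<a+N. u n)\<^sup>2 \<le>
    2 * real N / (real H)\<^sup>2 * (\<Sum>n=a..<a+N. (\<Sum>j<H. u (n + j))\<^sup>2)
    + 4 * real H * ((\<Sum>n=a..<a+H. (u n)\<^sup>2) + (\<Sum>n=a+N..<a+N+H. (u n)\<^sup>2))"
proof -
  define S where "S = (\<Sum>n=a..<a+N. u n)"
  define D where "D = (\<Sum>n=a..<a+N. \<Sum>j<H. u (n + j))"
  define E1 where "E1 = (\<Sum>n=a..<a+H. \<bar>u n\<bar>)"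
  define E2 where "E2 = (\<Sum>n=a+N..<a+N+H. \<bar>u n\<bar>)"
  define W where "W = (\<Sum>n=a..<a+H. (u n)\<^sup>2) + (\<Sum>n=a+N..<a+N+H. (u n)\<^sup>2)"
  have err: "\<bar>S - (\<Sum>n=a..<a+N. u (n + j))\<bar> \<le> E1 + E2" if "j < H" for j
  proof -
    have "(\<Sum>n=a..<a+N. u (n + j)) = (\<Sum>n=a+j..<a+N+j. u n)"
      by (simp add: sum.shift_bounds_nat_ivl)
    moreover have "S + (\<Sum>n=a+N..<a+N+j. u n) = (\<Sum>n=a..<a+N+j. u n)"
      unfolding S_def by (rule sum.atLeastLessThan_concat) auto
    moreover have "(\<Sum>n=a..<a+j. u n) + (\<Sum>n=a+j..<a+N+j. u n) = (\<Sum>n=a..<a+N+j. u n)"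
      by (rule sum.atLeastLessThan_concat) auto
    moreover have "\<bar>\<Sum>n=a..<a+j. u n\<bar> \<le> E1"
    proof -
      have "\<bar>\<Sum>n=a..<a+j. u n\<bar> \<le> (\<Sum>n=a..<a+j. \<bar>u n\<bar>)" by (rule sum_abs)
      also have "\<dots> \<le> E1" unfolding E1_def using that by (intro sum_mono2) auto
      finally show ?thesis .
    qed
    moreover have "\<bar>\<Sum>n=a+N..<a+N+j. u n\<bar> \<le> E2"
    proof -
      have "\<bar>\<Sum>n=a+N..<a+N+j. u n\<bar> \<le> (\<Sum>n=a+N..<a+N+j. \<bar>u n\<bar>)" by (rule sum_abs)
      also have "\<dots> \<le> E2" unfolding E2_def using that by (intro sum_mono2) auto
      finally show ?thesis .
    qed
    ultimately show ?thesis by linarith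
  qed
  have "D = (\<Sum>j<H. \<Sum>n=a..<a+N. u (n + j))" unfolding D_def by (rule sum.swap)
  then have "H * S - D = (\<Sum>j<H. S - (\<Sum>n=a..<a+N. u (n + j)))"
    by (simp add: sum_subtractf)
  also have "\<bar>\<dots>\<bar> \<le> (\<Sum>j<H. E1 + E2)"
    by (rule order_trans[OF sum_abs sum_mono]) (use err in auto)
  finally have HS: "\<bar>H * S - D\<bar> \<le> H * (E1 + E2)" by simp
  \<comment> \<open>This is the nonnegativity of the square of \<open>H * S - 2 * D\<close>,
    expanded.\<close>
  have "(H * S)\<^sup>2 \<le> 2 * D\<^sup>2 + 2 * (H * S - D)\<^sup>2"
    using zero_le_power2[of "H * S - 2 * D"] by (simp add: power2_eq_square algebra_simps)
  moreover have "(H * S - D)\<^sup>2 \<le> (real H)\<^sup>2 * (E1 + E2)\<^sup>2"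
    using HS power_mono[of "\<bar>H * S - D\<bar>" "H * (E1 + E2)" 2] by (simp add: power_mult_distrib)
  moreover have "(real H)\<^sup>2 * (E1 + E2)\<^sup>2 \<le> (real H)\<^sup>2 * (2 * H * W)"
  proof (rule mult_left_mono)
    have "(E1 + E2)\<^sup>2 \<le> 2 * E1\<^sup>2 + 2 * E2\<^sup>2"
      using zero_le_power2[of "E1 - E2"] by (simp add: power2_eq_square algebra_simps)
    moreover have "E1\<^sup>2 \<le> (\<Sum>n=a..<a+H. \<bar>u n\<bar>\<^sup>2) * H"
      unfolding E1_def using sum_squared_le_sum_of_squares[of "\<lambda>n. \<bar>u n\<bar>" "{a..<a+H}"] by simp
    moreover have "E2\<^sup>2 \<le> (\<Sum>n=a+N..<a+N+H. \<bar>u n\<bar>\<^sup>2) * H"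
      unfolding E2_def using sum_squared_le_sum_of_squares[of "\<lambda>n. \<bar>u n\<bar>" "{a+N..<a+N+H}"] by simp
    ultimately show "(E1 + E2)\<^sup>2 \<le> 2 * H * W" by (simp add: W_def algebra_simps)
  qed simp
  moreover have "D\<^sup>2 \<le> (\<Sum>n=a..<a+N. (\<Sum>j<H. u (n + j))\<^sup>2) * N"
    unfolding D_def
    using sum_squared_le_sum_of_squares[of "\<lambda>n. \<Sum>j<H. u (n + j)" "{a..<a+N}"] by simp
  ultimately have "(real H)\<^sup>2 * S\<^sup>2 \<le>
      2 * ((\<Sum>n=a..<a+N. (\<Sum>j<H. u (n + j))\<^sup>2) * N) + (real H)\<^sup>2 * (4 * H * W)"
    unfolding power_mult_distrib by linarith
  then have "S\<^sup>2 \<le> (2 * ((\<Sum>n=a..<a+N. (\<Sum>j<H. u (n + j))\<^sup>2) * N) + (real H)\<^sup>2 * (4 * real H * W)) / (real H)\<^sup>2"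
    using assms by (subst pos_le_divide_eq) (auto simp: mult.commute)
  also have "\<dots> = 2 * real N / (real H)\<^sup>2 * (\<Sum>n=a..<a+N. (\<Sum>j<H. u (n + j))\<^sup>2) + 4 * real H * W"
    using assms by (simp add: field_simps)
  finally show ?thesis unfolding S_def W_def .
qed

section \<open>Truncated sums along integer sequences\<close>

text \<open>Extension by zero lets the translation variable range over arbitrary finite sets of
  integers, while the sums of squares stay bounded by \<open>L\<close> when \<open>g\<close> is
  bounded by 1.\<close>

definition trunc :: "(int \<Rightarrow> real) \<Rightarrow> nat \<Rightarrow> int \<Rightarrow> real" where
  "trunc g L x = (if 1 \<le> x \<and> x \<le> int L then g x else 0)"

lemma sum_trunc_square_le:
  assumes "\<And>x. \<bar>g x\<bar> \<le> 1" and "finite X"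
  shows "(\<Sum>x\<in>X. (trunc g L (x + c))\<^sup>2) \<le> L"
proof -
  have "(\<Sum>x\<in>X. (trunc g L (x + c))\<^sup>2) \<le> (\<Sum>x\<in>X. if x \<in> {1 - c..int L - c} then 1 else 0)"
  proof (rule sum_mono)
    fix x
    have "(g (x + c))\<^sup>2 \<le> 1" using assms(1)[of "x + c"] by (simp add: abs_square_le_1)
    then show "(trunc g L (x + c))\<^sup>2 \<le> (if x \<in> {1 - c..int L - c} then 1 else 0)"
      by (auto simp: trunc_def)
  qed
  also have "\<dots> = card (X \<inter> {1 - c..int L - c})"
    using assms(2) by (simp add: sum.If_cases del: atLeastAtMost_iff)
  also have "\<dots> \<le> card {1 - c..int L - c}" by (intro of_nat_mono card_mono) auto
  also have "\<dots> = L" by simp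
  finally show ?thesis .
qed

text \<open>Each of the \<open>2 * H\<close> boundary squares costs at most \<open>L\<close> after
  summation over \<open>x\<close>; with the factor \<open>4 * H\<close> this gives an error that
  does not grow with \<open>N\<close>.\<close>

lemma van_der_corput_trunc:
  fixes a H N L :: nat
  assumes g: "\<And>x. \<bar>g x\<bar> \<le> 1" and "H \<ge> 1" and fin: "finite X"
  shows "(\<Sum>x\<in>X. (\<Sum>n=a..<a+N. trunc g L (x + s n))\<^sup>2) \<le>
    2 * real N / (real H)\<^sup>2 * (\<Sum>n=a..<a+N. \<Sum>x\<in>X. (\<Sum>j<H. trunc g L (x + s (n + j)))\<^sup>2) + 8 * (real H)\<^sup>2 * L"
proof -
  let ?u = "\<lambda>x n. trunc g L (x + s n)"
  have "(\<Sum>x\<in>X. (\<Sum>n=a..<a+N. ?u x n)\<^sup>2) \<le>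
    (\<Sum>x\<in>X. 2 * real N / (real H)\<^sup>2 * (\<Sum>n=a..<a+N. (\<Sum>j<H. ?u x (n + j))\<^sup>2)
    + 4 * real H * ((\<Sum>n=a..<a+H. (?u x n)\<^sup>2) + (\<Sum>n=a+N..<a+N+H. (?u x n)\<^sup>2)))"
    by (intro sum_mono van_der_corput assms)
  also have "\<dots> = 2 * real N / (real H)\<^sup>2 * (\<Sum>n=a..<a+N. \<Sum>x\<in>X. (\<Sum>j<H. ?u x (n + j))\<^sup>2)
    + 4 * real H * ((\<Sum>n=a..<a+H. \<Sum>x\<in>X. (?u x n)\<^sup>2) + (\<Sum>n=a+N..<a+N+H. \<Sum>x\<in>X. (?u x n)\<^sup>2))"
    unfolding sum.distrib sum_distrib_left[symmetric] by (simp add: sum.swap[of _ X])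
  also have "\<dots> \<le> 2 * real N / (real H)\<^sup>2 * (\<Sum>n=a..<a+N. \<Sum>x\<in>X. (\<Sum>j<H. ?u x (n + j))\<^sup>2)
    + 4 * real H * ((\<Sum>n=a..<a+H. real L) + (\<Sum>n=a+N..<a+N+H. real L))"
    by (intro add_left_mono mult_left_mono add_mono sum_mono sum_trunc_square_le g fin) auto
  finally show ?thesis by (simp add: power2_eq_square mult.assoc)
qed

text \<open>For \<open>g\<close> bounded by 1 the trivial bound is \<open>L * N\<^sup>2\<close>, so
  an arbitrarily small factor is gained. Uniformity in \<open>a\<close> allows windows anywhere, and
  arbitrary finite \<open>X\<close> makes the property stable under changes of variable in
  \<open>x\<close>.\<close>

definition vanishing :: "(int \<Rightarrow> real) \<Rightarrow> (nat \<Rightarrow> int) \<Rightarrow> bool" where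
  "vanishing g s \<longleftrightarrow> (\<forall>\<epsilon>>0. \<exists>N0 L0. \<forall>N\<ge>N0. \<forall>L\<ge>L0. \<forall>a X. finite X \<longrightarrow>
     (\<Sum>x\<in>X. (\<Sum>n=a..<a+N. trunc g L (x + s n))\<^sup>2) \<le> \<epsilon> * real L * (real N)\<^sup>2)"

text \<open>The substitution \<open>y = x + b\<close> leaves only the difference
  \<open>c - b\<close>. The sum is unaffected by the choice of \<open>X\<close> once
  \<open>X\<close> contains every point where the first factor can be nonzero.\<close>

lemma sum_trunc_product:
  assumes "finite X" and "\<And>y. 1 \<le> y \<Longrightarrow> y \<le> int L \<Longrightarrow> y - b \<in> X"
  shows "(\<Sum>x\<in>X. trunc g L (x + b) * trunc g L (x + c)) =
    (\<Sum>y=1..int L. trunc g L y * trunc g L (y + (c - b)))"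
proof -
  have "(\<Sum>x\<in>X. trunc g L (x + b) * trunc g L (x + c)) =
     (\<Sum>x\<in>(\<lambda>y. y - b) ` {1..int L}. trunc g L (x + b) * trunc g L (x + c))"
  proof (rule sum.mono_neutral_right)
    have "trunc g L (x + b) = 0" if "x \<notin> (\<lambda>y. y - b) ` {1..int L}" for x
    proof -
      have "x + b \<notin> {1..int L}" using that by (metis add_diff_cancel_right' imageI)
      then show ?thesis by (auto simp: trunc_def)
    qed
    then show "\<forall>x\<in>X - (\<lambda>y. y - b) ` {1..int L}. trunc g L (x + b) * trunc g L (x + c) = 0"
      by simp
  next
    show "(\<lambda>y. y - b) ` {1..int L} \<subseteq> X"
      using assms(2) by (intro image_subsetI) auto
  qed (use assms in auto)
  also have "\<dots> = (\<Sum>y=1..int L. trunc g L (y - b + b) * trunc g L (y - b + c))"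
    by (subst sum.reindex) (auto simp: inj_on_def)
  finally show ?thesis by (simp add: algebra_simps)
qed

text \<open>Cauchy-Schwarz in \<open>y\<close>, after moving the sum over \<open>n\<close> inside:
  the first factor has square sum at most \<open>L\<close>, the second is controlled by
  \<open>bd\<close>.\<close>

lemma sum_autocorrelation_le:
  assumes g: "\<And>x. \<bar>g x\<bar> \<le> 1" and "\<delta> \<ge> 0"
    and bd: "(\<Sum>y=1..int L. (\<Sum>n=a..<a+N. trunc g L (y + t n))\<^sup>2) \<le> \<delta>\<^sup>2 * real L * (real N)\<^sup>2"
  shows "(\<Sum>n=a..<a+N. \<Sum>y=1..int L. trunc g L y * trunc g L (y + t n)) \<le> \<delta> * L * N"
proof -
  have "(\<Sum>n=a..<a+N. \<Sum>y=1..int L. trunc g L y * trunc g L (y + t n)) =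
    (\<Sum>y=1..int L. trunc g L y * (\<Sum>n=a..<a+N. trunc g L (y + t n)))" (is "?lhs = _")
    by (subst sum.swap) (simp add: sum_distrib_left)
  then have "?lhs\<^sup>2 \<le> (\<Sum>y=1..int L. (trunc g L y)\<^sup>2) * (\<Sum>y=1..int L. (\<Sum>n=a..<a+N. trunc g L (y + t n))\<^sup>2)"
    using Cauchy_Schwarz_ineq_sum[of "trunc g L" "\<lambda>y. \<Sum>n=a..<a+N. trunc g L (y + t n)" "{1..int L}"]
    by simp
  also have "\<dots> \<le> L * (\<delta>\<^sup>2 * real L * (real N)\<^sup>2)"
    using sum_trunc_square_le[of g "{1..int L}" L 0] g
    by (intro mult_mono bd) (auto intro!: sum_nonneg)
  also have "\<dots> = (\<delta> * L * N)\<^sup>2" by (simp add: power2_eq_square algebra_simps)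
  finally show ?thesis by (rule power2_le_imp_le) (use \<open>\<delta> \<ge> 0\<close> in simp)
qed

text \<open>Van der Corput turns the square sum into correlations \<open>C i j\<close> with
  \<open>i, j < H\<close>. The diagonal ones are at most \<open>L * N\<close> and contribute a share
  of order \<open>1 / H\<close>; off the diagonal, a translation in \<open>x\<close> leaves only a
  difference sequence of lag between 1 and \<open>H - 1\<close>.\<close>

lemma vanishing_if_differences_vanishing:
  assumes g: "\<And>x. \<bar>g x\<bar> \<le> 1"
    and diff: "\<And>h. h \<ge> 1 \<Longrightarrow> vanishing g (\<lambda>n. s (n + h) - s n)"
  shows "vanishing g s"
  unfolding vanishing_def
proof (intro allI impI)
  fix \<epsilon> :: real assume "\<epsilon> > 0"
  \<comment> \<open>The errors \<open>2 / H\<close> from the diagonal, \<open>2 * \<delta>\<close>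
    from the other correlations, and the boundary term are allotted \<open>\<epsilon> / 3\<close>
    each.\<close>
  define \<delta> where "\<delta> = \<epsilon> / 6"
  have "\<delta> > 0" using \<open>\<epsilon> > 0\<close> by (simp add: \<delta>_def)
  obtain H :: nat where "H > 6 / \<epsilon>" using reals_Archimedean2 by blast
  moreover have "6 / \<epsilon> > 0" using \<open>\<epsilon> > 0\<close> by simp
  ultimately have "real H > 0" by linarith
  then have H: "H \<ge> 1" "2 / H \<le> \<epsilon> / 3"
    using \<open>H > 6 / \<epsilon>\<close> \<open>\<epsilon> > 0\<close> by (auto simp: field_simps)
  define P where "P h N0 L0 \<longleftrightarrow> (\<forall>N\<ge>N0. \<forall>L\<ge>L0. \<forall>a X. finite X \<longrightarrow>
     (\<Sum>x\<in>X. (\<Sum>n=a..<a+N. trunc g L (x + (s (n + h) - s n)))\<^sup>2) \<le> \<delta>\<^sup>2 * real L * (real N)\<^sup>2)"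
    for h N0 L0
  have "\<exists>N0 L0. P h N0 L0" if "h \<ge> 1" for h
    using diff[OF that] \<open>\<delta> > 0\<close> unfolding vanishing_def P_def by simp
  then obtain N0 L0 where P: "\<And>h. h \<ge> 1 \<Longrightarrow> P h (N0 h) (L0 h)" by metis
  have bd: "(\<Sum>x\<in>X. (\<Sum>n=a..<a+N. trunc g L (x + (s (n + h) - s n)))\<^sup>2) \<le> \<delta>\<^sup>2 * real L * (real N)\<^sup>2"
    if "h \<ge> 1" "N \<ge> N0 h" "L \<ge> L0 h" "finite X" for h N L a X
    using P[of h] that unfolding P_def by simp
  obtain K :: nat where K: "K > 24 * (real H)\<^sup>2 / \<epsilon>" using reals_Archimedean2 by blast
  \<comment> \<open>Only the finitely many lags \<open>h < H\<close> occur, so the sums of their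
    thresholds majorize each one; \<open>K\<close> makes the boundary term small.\<close>
  define N1 where "N1 = K + 1 + (\<Sum>h<H. N0 h)"
  define L1 where "L1 = (\<Sum>h<H. L0 h)"
  have le: "N0 h \<le> N1" "L0 h \<le> L1" if "h < H" for h
    using that member_le_sum[of h "{..<H}" N0] member_le_sum[of h "{..<H}" L0]
    by (auto simp: N1_def L1_def)
  show "\<exists>N0 L0. \<forall>N\<ge>N0. \<forall>L\<ge>L0. \<forall>a X. finite X \<longrightarrow>
     (\<Sum>x\<in>X. (\<Sum>n=a..<a+N. trunc g L (x + s n))\<^sup>2) \<le> \<epsilon> * real L * (real N)\<^sup>2"
  proof (intro exI allI impI)
    fix N L a :: nat and X :: "int set"
    assume N: "N1 \<le> N" and L: "L1 \<le> L" and "finite X"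
    \<comment> \<open>Adding all \<open>x\<close> at which some term of the extended window can be
      nonzero only increases the sum of squares and makes the changes of variable exact.\<close>
    define X' where "X' = X \<union> (\<Union>n\<in>{a..<a+N+H}. (\<lambda>y. y - s n) ` {1..int L})"
    have X': "finite X'" "X \<subseteq> X'"
      "\<And>n y. a \<le> n \<Longrightarrow> n < a + N + H \<Longrightarrow> 1 \<le> y \<Longrightarrow> y \<le> int L \<Longrightarrow> y - s n \<in> X'"
      using \<open>finite X\<close> unfolding X'_def by (simp, blast, intro UnI2 UN_I imageI) auto
    let ?u = "\<lambda>x n. trunc g L (x + s n)"
    define C where "C i j = (\<Sum>n=a..<a+N. \<Sum>x\<in>X'. ?u x (n + i) * ?u x (n + j))" for i j
    have C_less: "C i j \<le> \<delta> * L * N" if "i < j" "j < H" for i j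
    proof -
      have "C i j = (\<Sum>n=a..<a+N. \<Sum>y=1..int L. trunc g L y * trunc g L (y + (s (n + j) - s (n + i))))"
        unfolding C_def using that
        by (intro sum.cong refl sum_trunc_product X') auto
      \<comment> \<open>Re-indexing leaves the lag \<open>j - i\<close> but moves the start of the
        window to \<open>a + i\<close>; the uniformity of \<open>vanishing\<close> in the position
        covers this.\<close>
      also have "\<dots> = (\<Sum>n=a+i..<a+i+N. \<Sum>y=1..int L. trunc g L y * trunc g L (y + (s (n + (j - i)) - s n)))"
        using sum.shift_bounds_nat_ivl[of "\<lambda>n. \<Sum>y=1..int L. trunc g L y * trunc g L (y + (s (n + (j - i)) - s n))" a i "a + N"] that
        by (simp add: algebra_simps)
      also have "\<dots> \<le> \<delta> * L * N"
      proof (rule sum_autocorrelation_le)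
        have "j - i < H" using that by simp
        then show "(\<Sum>y=1..int L. (\<Sum>n=a+i..<a+i+N. trunc g L (y + (s (n + (j - i)) - s n)))\<^sup>2)
            \<le> \<delta>\<^sup>2 * real L * (real N)\<^sup>2"
          using that N L le[of "j - i"] by (intro bd) auto
      qed (use g \<open>\<delta> > 0\<close> in auto)
      finally show ?thesis .
    qed
    have C_commute: "C i j = C j i" for i j
      unfolding C_def by (simp add: mult.commute)
    have C_diag: "C i i \<le> L * N" for i
    proof -
      have "C i i = (\<Sum>n=a..<a+N. \<Sum>x\<in>X'. (?u x (n + i))\<^sup>2)"
        by (simp add: C_def power2_eq_square)
      also have "\<dots> \<le> (\<Sum>n=a..<a+N. real L)"
        by (intro sum_mono sum_trunc_square_le g X')
      finally show ?thesis by (simp add: algebra_simps)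
    qed
    have C_le: "C i j \<le> (if i = j then real L * N else 0) + \<delta> * L * N" if "i < H" "j < H" for i j
      using C_less[of i j] C_less[of j i] C_commute[of i j] C_diag[of i] that \<open>\<delta> > 0\<close>
      by (cases i j rule: linorder_cases) (auto intro: add_increasing2)
    have "(\<Sum>x\<in>X. (\<Sum>n=a..<a+N. ?u x n)\<^sup>2) \<le> (\<Sum>x\<in>X'. (\<Sum>n=a..<a+N. ?u x n)\<^sup>2)"
      using X' by (intro sum_mono2) auto
    also have "\<dots> \<le> 2 * real N / (real H)\<^sup>2 * (\<Sum>n=a..<a+N. \<Sum>x\<in>X'. (\<Sum>j<H. ?u x (n + j))\<^sup>2) + 8 * (real H)\<^sup>2 * L"
      by (intro van_der_corput_trunc g H X')
    also have "(\<Sum>n=a..<a+N. \<Sum>x\<in>X'. (\<Sum>j<H. ?u x (n + j))\<^sup>2) = (\<Sum>i<H. \<Sum>j<H. C i j)"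
    proof -
      have "(\<Sum>n=a..<a+N. \<Sum>x\<in>X'. (\<Sum>j<H. ?u x (n + j))\<^sup>2) =
        (\<Sum>n=a..<a+N. \<Sum>x\<in>X'. \<Sum>i<H. \<Sum>j<H. ?u x (n + i) * ?u x (n + j))"
        by (simp add: power2_eq_square sum_product)
      also have "\<dots> = (\<Sum>i<H. \<Sum>j<H. C i j)"
        unfolding C_def
        by (simp only: sum.swap[of _ "{..<H}" X'] sum.swap[of _ "{..<H}" "{a..<a+N}"])
      finally show ?thesis .
    qed
    also have "(\<Sum>i<H. \<Sum>j<H. C i j) \<le> (\<Sum>i<H. \<Sum>j<H. (if i = j then real L * N else 0) + \<delta> * L * N)"
      using C_le by (intro sum_mono) auto
    also have "\<dots> = H * (real L * N) + (real H)\<^sup>2 * (\<delta> * L * N)"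
      by (simp add: sum.distrib power2_eq_square algebra_simps)
    finally have main: "(\<Sum>x\<in>X. (\<Sum>n=a..<a+N. ?u x n)\<^sup>2) \<le>
        2 * real N / (real H)\<^sup>2 * (H * (real L * N) + (real H)\<^sup>2 * (\<delta> * L * N)) + 8 * (real H)\<^sup>2 * L"
      by (simp add: mult_left_mono divide_right_mono)
    have "2 * real N / (real H)\<^sup>2 * (H * (real L * N) + (real H)\<^sup>2 * (\<delta> * L * N)) =
        (2 / H + 2 * \<delta>) * (real L * (real N)\<^sup>2)"
      using H(1) by (simp add: power2_eq_square field_simps)
    moreover have "(2 / H + 2 * \<delta>) * (real L * (real N)\<^sup>2) \<le> (\<epsilon> / 3 + \<epsilon> / 3) * (real L * (real N)\<^sup>2)"
      using H(2) by (intro mult_right_mono) (auto simp: \<delta>_def)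
    moreover have "8 * (real H)\<^sup>2 * L \<le> (\<epsilon> / 3 * (real N)\<^sup>2) * L"
    proof (rule mult_right_mono)
      have "24 * (real H)\<^sup>2 \<le> \<epsilon> * K" using K \<open>\<epsilon> > 0\<close> by (simp add: field_simps)
      also have "\<dots> \<le> \<epsilon> * N" using N \<open>\<epsilon> > 0\<close> by (simp add: N1_def)
      also have "\<dots> \<le> \<epsilon> * (real N)\<^sup>2"
        using N \<open>\<epsilon> > 0\<close> by (simp add: N1_def power2_eq_square)
      finally show "8 * (real H)\<^sup>2 \<le> \<epsilon> / 3 * (real N)\<^sup>2" by simp
    qed simp
    moreover have "(\<epsilon> / 3 + \<epsilon> / 3) * (real L * (real N)\<^sup>2) + (\<epsilon> / 3 * (real N)\<^sup>2) * L
        = \<epsilon> * real L * (real N)\<^sup>2"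
      by (simp add: algebra_simps)
    ultimately show "(\<Sum>x\<in>X. (\<Sum>n=a..<a+N. ?u x n)\<^sup>2) \<le> \<epsilon> * real L * (real N)\<^sup>2"
      using main by linarith
  qed
qed

text \<open>After one application of van der Corput the inner sums run along progressions of step
  \<open>t\<close>, whose mean square \<open>avg\<close> controls. Truncation matters only for the
  \<open>O(t * H)\<close> progressions near an end of \<open>[1, L]\<close>, which is negligible for
  large \<open>L\<close>.\<close>

lemma vanishing_linear:
  assumes g: "\<And>x. \<bar>g x\<bar> \<le> 1" and "t \<ge> 1"
    and avg: "\<And>\<eta>. \<eta> > 0 \<Longrightarrow> \<exists>H\<ge>1. \<exists>L0. \<forall>L\<ge>L0.
      (\<Sum>y=1..int L. (\<Sum>j<H. g (y + t * int j))\<^sup>2) \<le> \<eta> * (real H)\<^sup>2 * real L"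
  shows "vanishing g (\<lambda>n. t * int n + c)"
  unfolding vanishing_def
proof (intro allI impI)
  fix \<epsilon> :: real assume "\<epsilon> > 0"
  obtain H L0 where "H \<ge> 1" and avg_le: "\<And>L. L \<ge> L0 \<Longrightarrow>
      (\<Sum>y=1..int L. (\<Sum>j<H. g (y + t * int j))\<^sup>2) \<le> \<epsilon> / 8 * (real H)\<^sup>2 * real L"
    using avg[of "\<epsilon> / 8"] \<open>\<epsilon> > 0\<close> by auto
  define G where "G L y = (\<Sum>j<H. trunc g L (y + t * int j))\<^sup>2" for L and y :: int
  have window: "(\<Sum>y\<in>Y. G L y) \<le> \<epsilon> / 8 * (real H)\<^sup>2 * L + 2 * t * (real H)^3"
    if "finite Y" "L \<ge> L0" for L Y
  proof -
    \<comment> \<open>Off \<open>E\<close> the progression \<open>y + t * j\<close> with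
      \<open>j < H\<close> lies wholly inside \<open>[1, L]\<close> or wholly outside it.\<close>
    define E where "E = {1 - t * int H..0} \<union> {int L + 1 - t * int H..int L}"
    have "G L y \<le> (if y \<in> {1..int L} then (\<Sum>j<H. g (y + t * int j))\<^sup>2 else 0)
        + (if y \<in> E then (real H)\<^sup>2 else 0)" for y
    proof (cases "y \<in> E")
      case True
      have "\<bar>\<Sum>j<H. trunc g L (y + t * int j)\<bar> \<le> (\<Sum>j<H. 1)"
        by (rule order_trans[OF sum_abs sum_mono]) (use g in \<open>auto simp: trunc_def\<close>)
      then have "G L y \<le> (real H)\<^sup>2"
        unfolding G_def using abs_le_square_iff[of "\<Sum>j<H. trunc g L (y + t * int j)" "real H"] by simp
      then show ?thesis using True by (auto intro: add_increasing)
    next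
      case y: False
      have less: "0 \<le> t * int j \<and> t * int j \<le> t * int H - t" if "j < H" for j
      proof -
        have "t * int j \<le> t * (int H - 1)" using that \<open>t \<ge> 1\<close> by (intro mult_left_mono) auto
        then show ?thesis using \<open>t \<ge> 1\<close> by (simp add: algebra_simps)
      qed
      show ?thesis
      proof (cases "y \<in> {1..int L}")
        case True
        have "trunc g L (y + t * int j) = g (y + t * int j)" if "j < H" for j
        proof -
          have "y \<le> int L - t * int H" using True y by (auto simp: E_def)
          then have "1 \<le> y + t * int j" "y + t * int j \<le> int L"
            using less[OF that] True \<open>t \<ge> 1\<close> by (simp_all only: atLeastAtMost_iff, linarith+)
          then show ?thesis by (simp add: trunc_def)
        qed
        then show ?thesis using True y by (simp add: G_def)
      next
        case False
        have "trunc g L (y + t * int j) = 0" if "j < H" for j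
        proof -
          have "y \<le> - t * int H \<or> int L < y" using False y by (auto simp: E_def)
          then have "y + t * int j < 1 \<or> int L < y + t * int j"
            using less[OF that] \<open>t \<ge> 1\<close> by linarith
          then show ?thesis by (auto simp: trunc_def)
        qed
        then show ?thesis by (simp add: G_def)
      qed
    qed
    then have "(\<Sum>y\<in>Y. G L y) \<le> (\<Sum>y\<in>Y. (if y \<in> {1..int L} then (\<Sum>j<H. g (y + t * int j))\<^sup>2 else 0)
        + (if y \<in> E then (real H)\<^sup>2 else 0))"
      by (intro sum_mono)
    also have "\<dots> = (\<Sum>y\<in>Y \<inter> {1..int L}. (\<Sum>j<H. g (y + t * int j))\<^sup>2) + card (Y \<inter> E) * (real H)\<^sup>2"
      using \<open>finite Y\<close> by (simp add: sum.distrib sum.If_cases del: atLeastAtMost_iff)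
    also have "\<dots> \<le> (\<Sum>y=1..int L. (\<Sum>j<H. g (y + t * int j))\<^sup>2) + (2 * t * H) * (real H)\<^sup>2"
    proof (intro add_mono mult_right_mono sum_mono2)
      have "card (Y \<inter> E) \<le> card E" by (intro card_mono) (auto simp: E_def)
      also have "\<dots> \<le> card {1 - t * int H..0} + card {int L + 1 - t * int H..int L}"
        unfolding E_def by (rule card_Un_le)
      also have "\<dots> = nat (2 * t * int H)"
        using \<open>t \<ge> 1\<close> by (simp add: nat_mult_distrib)
      finally have "int (card (Y \<inter> E)) \<le> int (nat (2 * t * int H))" by (simp only: of_nat_le_iff)
      then have "int (card (Y \<inter> E)) \<le> 2 * t * int H" using \<open>t \<ge> 1\<close> by simp
      then show "real (card (Y \<inter> E)) \<le> 2 * t * H"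
        by (metis of_int_le_iff of_int_mult of_int_numeral of_int_of_nat_eq)
    qed auto
    also have "\<dots> \<le> \<epsilon> / 8 * (real H)\<^sup>2 * L + 2 * t * (real H)^3"
      using avg_le[OF \<open>L \<ge> L0\<close>] by (simp add: power2_eq_square power3_eq_cube)
    finally show ?thesis .
  qed
  \<comment> \<open>\<open>K1\<close> is a threshold for \<open>L\<close> that absorbs the
    contribution of \<open>E\<close>; \<open>K2\<close> is a threshold for \<open>N\<close> that
    absorbs the boundary term of van der Corput. Each of these costs
    \<open>\<epsilon> / 4\<close>.\<close>
  obtain K1 :: nat where K1: "K1 > 16 * t * H / \<epsilon>" using reals_Archimedean2 by blast
  obtain K2 :: nat where K2: "K2 > 32 * (real H)\<^sup>2 / \<epsilon>" using reals_Archimedean2 by blast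
  show "\<exists>N0 L0. \<forall>N\<ge>N0. \<forall>L\<ge>L0. \<forall>a X. finite X \<longrightarrow>
     (\<Sum>x\<in>X. (\<Sum>n=a..<a+N. trunc g L (x + (t * int n + c)))\<^sup>2) \<le> \<epsilon> * real L * (real N)\<^sup>2"
  proof (intro exI allI impI)
    fix N L a :: nat and X :: "int set"
    assume N: "max 1 K2 \<le> N" and L: "max L0 K1 \<le> L" and "finite X"
    have "(\<Sum>x\<in>X. (\<Sum>n=a..<a+N. trunc g L (x + (t * int n + c)))\<^sup>2) \<le>
      2 * real N / (real H)\<^sup>2 * (\<Sum>n=a..<a+N. \<Sum>x\<in>X. (\<Sum>j<H. trunc g L (x + (t * int (n + j) + c)))\<^sup>2)
      + 8 * (real H)\<^sup>2 * L"
      by (rule van_der_corput_trunc[where s = "\<lambda>n. t * int n + c"]) (use g \<open>H \<ge> 1\<close> \<open>finite X\<close> in auto)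
    \<comment> \<open>For each \<open>n\<close> the set of \<open>x\<close> is translated by
      \<open>t * n + c\<close>; since \<open>window\<close> holds for every finite set, its bound
      does not depend on \<open>n\<close>.\<close>
    also have "(\<Sum>n=a..<a+N. \<Sum>x\<in>X. (\<Sum>j<H. trunc g L (x + (t * int (n + j) + c)))\<^sup>2)
      = (\<Sum>n=a..<a+N. \<Sum>y\<in>(\<lambda>x. x + (t * int n + c)) ` X. G L y)"
      by (rule sum.cong[OF refl], subst sum.reindex) (auto simp: inj_on_def G_def algebra_simps)
    finally have "(\<Sum>x\<in>X. (\<Sum>n=a..<a+N. trunc g L (x + (t * int n + c)))\<^sup>2) \<le>
      2 * real N / (real H)\<^sup>2 * (\<Sum>n=a..<a+N. \<Sum>y\<in>(\<lambda>x. x + (t * int n + c)) ` X. G L y)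
      + 8 * (real H)\<^sup>2 * L" .
    also have "\<dots> \<le> 2 * real N / (real H)\<^sup>2 * (\<Sum>n=a..<a+N. \<epsilon> / 8 * (real H)\<^sup>2 * L + 2 * t * (real H)^3)
      + 8 * (real H)\<^sup>2 * L"
      using L \<open>finite X\<close> by (intro add_right_mono mult_left_mono sum_mono window) auto
    also have "\<dots> = (\<epsilon> / 4 * L) * (real N)\<^sup>2 + (4 * t * H) * (real N)\<^sup>2 + 8 * (real H)\<^sup>2 * L"
      using \<open>H \<ge> 1\<close> by (simp add: power2_eq_square power3_eq_cube field_simps)
    also have "\<dots> \<le> (\<epsilon> / 4 * L) * (real N)\<^sup>2 + (\<epsilon> / 4 * L) * (real N)\<^sup>2 + (\<epsilon> / 4 * (real N)\<^sup>2) * L"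
    proof (intro add_mono mult_right_mono order_refl)
      have "16 * t * H \<le> \<epsilon> * K1" using K1 \<open>\<epsilon> > 0\<close> by (simp add: field_simps)
      also have "\<dots> \<le> \<epsilon> * L" using L \<open>\<epsilon> > 0\<close> by simp
      finally show "4 * t * H \<le> \<epsilon> / 4 * L" by simp
      have "32 * (real H)\<^sup>2 \<le> \<epsilon> * K2" using K2 \<open>\<epsilon> > 0\<close> by (simp add: field_simps)
      also have "\<dots> \<le> \<epsilon> * N" using N \<open>\<epsilon> > 0\<close> by simp
      also have "\<dots> \<le> \<epsilon> * (real N)\<^sup>2" using N \<open>\<epsilon> > 0\<close> by (simp add: power2_eq_square)
      finally show "8 * (real H)\<^sup>2 \<le> \<epsilon> / 4 * (real N)\<^sup>2" by simp
    qed auto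
    also have "\<dots> = 3 / 4 * (\<epsilon> * L * (real N)\<^sup>2)" by simp
    also have "\<dots> \<le> \<epsilon> * L * (real N)\<^sup>2" using \<open>\<epsilon> > 0\<close> by simp
    finally show "(\<Sum>x\<in>X. (\<Sum>n=a..<a+N. trunc g L (x + (t * int n + c)))\<^sup>2) \<le> \<epsilon> * real L * (real N)\<^sup>2" .
  qed
qed

section \<open>Differencing and induction on the degree\<close>

text \<open>The difference of \<open>a + x * p(x)\<close> is \<open>x * q(x) + h * p(x + h)\<close>,
  where \<open>q\<close> is the difference of \<open>p\<close>. For nonconstant \<open>p\<close>
  both summands have the same degree and positive leading coefficients, so nothing cancels.\<close>

lemma poly_difference:
  fixes p :: "'a::linordered_idom poly"
  assumes "degree p > 0" and "lead_coeff p > 0" and "h > 0"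
  obtains q where "\<And>x. poly q x = poly p (x + h) - poly p x"
    and "degree q = degree p - 1" and "lead_coeff q > 0"
proof -
  have "\<exists>q. (\<forall>x. poly q x = poly p (x + h) - poly p x) \<and> degree q = degree p - 1 \<and> lead_coeff q > 0"
    using assms(1,2)
  proof (induction p)
    case 0
    then show ?case by simp
  next
    case (pCons a p)
    then have "p \<noteq> 0" by auto
    then have lead: "lead_coeff p > 0" using pCons.prems by simp
    show ?case
    proof (cases "degree p = 0")
      case True
      then obtain b where "p = [:b:]" by (auto elim: degree_eq_zeroE)
      then show ?thesis using lead \<open>h > 0\<close> by (intro exI[of _ "[:b * h:]"]) (auto simp: algebra_simps)
    next
      case False
      then have "degree p > 0" by simp
      then obtain q where q: "\<And>x. poly q x = poly p (x + h) - poly p x"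
        "degree q = degree p - 1" "lead_coeff q > 0"
        using pCons.IH[OF _ lead] by blast
      define r where "r = pCons 0 q + smult h (pcompose p [:h, 1:])"
      have "q \<noteq> 0" using q(3) by auto
      have top: "coeff r (degree p) = lead_coeff q + h * lead_coeff p"
      proof -
        have "coeff (pcompose p [:h, 1:]) (degree p) = lead_coeff p"
          using lead_coeff_comp[of "[:h, 1:]" p] by (simp add: degree_pcompose)
        then show ?thesis using False q(2) by (simp add: r_def coeff_pCons split: nat.split)
      qed
      then have "coeff r (degree p) > 0" using q(3) lead \<open>h > 0\<close> by (simp add: add_pos_pos)
      moreover have "degree r \<le> degree p"
        unfolding r_def using \<open>q \<noteq> 0\<close> q(2) False \<open>h > 0\<close>
        by (intro degree_add_le) (auto simp: degree_pcompose)
      ultimately have "degree r = degree p" by (metis le_degree le_antisym less_irrefl)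
      moreover have "poly r x = poly (pCons a p) (x + h) - poly (pCons a p) x" for x
        by (simp add: r_def poly_pcompose q(1) algebra_simps)
      ultimately show ?thesis
        using \<open>coeff r (degree p) > 0\<close> \<open>p \<noteq> 0\<close> by (intro exI[of _ r]) auto
    qed
  qed
  then obtain q where "\<And>x. poly q x = poly p (x + h) - poly p x"
    "degree q = degree p - 1" "lead_coeff q > 0" by blast
  then show ?thesis by (rule that)
qed

text \<open>Differencing lowers the degree by one and keeps the leading coefficient positive, so the
  descent ends at linear polynomials of slope at least 1, where \<open>avg\<close> applies.\<close>

lemma vanishing_poly:
  fixes p :: "int poly"
  assumes g: "\<And>x. \<bar>g x\<bar> \<le> 1"
    and avg: "\<And>t \<eta>. t \<ge> 1 \<Longrightarrow> \<eta> > 0 \<Longrightarrow> \<exists>H\<ge>1. \<exists>L0. \<forall>L\<ge>L0.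
      (\<Sum>y=1..int L. (\<Sum>j<H. g (y + t * int j))\<^sup>2) \<le> \<eta> * (real H)\<^sup>2 * real L"
    and "degree p > 0" "lead_coeff p > 0"
  shows "vanishing g (\<lambda>n. poly p (int n))"
  using assms(3,4)
proof (induction "degree p" arbitrary: p rule: less_induct)
  case less
  show ?case
  proof (cases "degree p = 1")
    case True
    obtain c q where p: "p = pCons c q" by (cases p)
    then have "degree q = 0" using True by (simp split: if_splits)
    then obtain t where "p = [:c, t:]" using p by (auto elim: degree_eq_zeroE)
    then have "t > 0" using less.prems by (simp split: if_splits)
    then have "vanishing g (\<lambda>n. t * int n + c)"
      using \<open>t > 0\<close> by (intro vanishing_linear g avg) auto
    then show ?thesis using \<open>p = [:c, t:]\<close> by (simp add: algebra_simps)
  next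
    case False
    show ?thesis
    proof (rule vanishing_if_differences_vanishing[OF g])
      fix h :: nat assume "h \<ge> 1"
      then obtain q where q: "\<And>x. poly q x = poly p (x + int h) - poly p x"
        "degree q = degree p - 1" "lead_coeff q > 0"
        using poly_difference[of p "int h"] less.prems by (metis of_nat_0_less_iff less_eq_Suc_le One_nat_def)
      have "vanishing g (\<lambda>n. poly q (int n))"
        using less.prems False q by (intro less.hyps) auto
      then show "vanishing g (\<lambda>n. poly p (int (n + h)) - poly p (int n))" by (simp add: q(1))
    qed
  qed
qed

section \<open>Growth of integer polynomials\<close>

text \<open>By integrality an eventually positive \<open>p(n)\<close> is at least 1, so
  \<open>a + n * p(n)\<close> is positive once \<open>n > |a|\<close>.\<close>

lemma eventually_poly_pos:
  fixes p :: "int poly"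
  assumes "lead_coeff p > 0"
  shows "eventually (\<lambda>n. poly p (int n) > 0) sequentially"
  using assms
proof (induction p)
  case 0
  then show ?case by simp
next
  case (pCons a p)
  show ?case
  proof (cases "p = 0")
    case True
    then show ?thesis using pCons.prems by simp
  next
    case False
    then have "eventually (\<lambda>n. poly p (int n) > 0) sequentially" using pCons by simp
    moreover have "eventually (\<lambda>n. int n > \<bar>a\<bar>) sequentially"
      using eventually_gt_at_top[of "nat \<bar>a\<bar>"] by eventually_elim simp
    ultimately show ?thesis
    proof eventually_elim
      case (elim n)
      have "int n * 1 \<le> int n * poly p (int n)" using elim by (intro mult_left_mono) auto
      then show ?case using elim by simp
    qed
  qed
qed

lemma eventually_poly_less_shift:
  fixes p :: "int poly"
  assumes "degree p > 0" and "lead_coeff p > 0"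
  shows "eventually (\<lambda>n. poly p (int n) < poly p (int (Suc n))) sequentially"
proof -
  obtain q where q: "\<And>x. poly q x = poly p (x + 1) - poly p x" "lead_coeff q > 0"
    using poly_difference[of p 1] assms by (metis zero_less_one)
  show ?thesis using eventually_poly_pos[OF q(2)] by eventually_elim (simp add: q(1) add.commute)
qed

text \<open>The polynomial \<open>2 * p(x) - p(x + k)\<close> has the same leading coefficient as
  \<open>p\<close>. This keeps the values on a window of bounded length below
  \<open>2 * M\<close>.\<close>

lemma eventually_poly_shift_le_double:
  fixes p :: "int poly"
  assumes "lead_coeff p > 0"
  shows "eventually (\<lambda>n. poly p (int (n + k)) \<le> 2 * poly p (int n)) sequentially"
proof -
  define q where "q = smult 2 p - pcompose p [:int k, 1:]"
  have "coeff (pcompose p [:int k, 1:]) (degree p) = lead_coeff p"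
    using lead_coeff_comp[of "[:int k, 1:]" p] by (simp add: degree_pcompose)
  then have pos: "coeff q (degree p) > 0" using assms by (simp add: q_def)
  have "degree q \<le> degree p" unfolding q_def by (intro degree_diff_le) (auto simp: degree_pcompose)
  with pos have "degree q = degree p" by (metis le_degree le_antisym less_irrefl)
  then have "lead_coeff q > 0" using pos by simp
  from eventually_poly_pos[OF this] show ?thesis
    by eventually_elim (simp add: q_def poly_pcompose add.commute)
qed

section \<open>Cancellation forces a value in the sumset\<close>

text \<open>If the window missed \<open>A + B\<close>, then \<open>g (s n - b)\<close> would be
  \<open>- \<alpha>\<close> for every \<open>n\<close> in it and every \<open>b \<le> M\<close> in
  \<open>B\<close>, leaving no cancellation. The length \<open>N\<close> is fixed before
  \<open>M\<close> and \<open>a\<close>.\<close>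

lemma sumset_meets_window:
  fixes A B :: "nat set" and \<alpha> \<delta> :: real
  defines "g \<equiv> \<lambda>x. if x \<ge> 1 then indicator A (nat x) - \<alpha> else 0"
  assumes "vanishing g s" and "\<alpha> > 0" and "\<delta> > 0"
  obtains N M0 where "\<And>M a. \<lbrakk>M \<ge> M0; \<delta> * real M \<le> real (card (B \<inter> {1..M}));
    \<And>n. a \<le> n \<Longrightarrow> n < a + N \<Longrightarrow> int M < s n \<and> s n \<le> 2 * int M\<rbrakk> \<Longrightarrow>
    \<exists>n. a \<le> n \<and> n < a + N \<and> s n \<in> int ` (A + B)"
proof -
  \<comment> \<open>With \<open>L = 2 * M\<close> the upper bound becomes
    \<open>\<delta> * M * \<alpha>\<^sup>2 * N\<^sup>2 / 2\<close>, half of the lower bound.\<close>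
  define \<epsilon> where "\<epsilon> = \<delta> * \<alpha>\<^sup>2 / 4"
  have "\<epsilon> > 0" using assms by (simp add: \<epsilon>_def)
  then obtain N0 L0 where bd: "\<And>N L a X. N \<ge> N0 \<Longrightarrow> L \<ge> L0 \<Longrightarrow> finite X \<Longrightarrow>
     (\<Sum>x\<in>X. (\<Sum>n=a..<a+N. trunc g L (x + s n))\<^sup>2) \<le> \<epsilon> * real L * (real N)\<^sup>2"
    using \<open>vanishing g s\<close> unfolding vanishing_def by meson
  show ?thesis
  proof (rule that, rule ccontr)
    fix M a :: nat
    assume M: "max 1 L0 \<le> M" and B: "\<delta> * real M \<le> real (card (B \<inter> {1..M}))"
      and win: "\<And>n. a \<le> n \<Longrightarrow> n < a + max 1 N0 \<Longrightarrow> int M < s n \<and> s n \<le> 2 * int M"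
      and none: "\<not> (\<exists>n. a \<le> n \<and> n < a + max 1 N0 \<and> s n \<in> int ` (A + B))"
    \<comment> \<open>The maximum with 1 keeps the window nonempty, so that \<open>N\<^sup>2\<close>
      can be cancelled.\<close>
    define N where "N = max 1 N0"
    define X where "X = (\<lambda>b. - int b) ` (B \<inter> {1..M})"
    \<comment> \<open>Since \<open>1 \<le> b \<le> M < s n \<le> 2 * M\<close>, the point
      \<open>s n - b\<close> stays in \<open>[1, 2 * M]\<close>, where truncation leaves
      \<open>g\<close> unchanged.\<close>
    have val: "trunc g (2 * M) (x + s n) = - \<alpha>" if "x \<in> X" "n \<in> {a..<a+N}" for x n
    proof -
      obtain b where b: "x = - int b" "b \<in> B" "1 \<le> b" "b \<le> M" using \<open>x \<in> X\<close> by (auto simp: X_def)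
      have s: "int M < s n" "s n \<le> 2 * int M" using win that by (auto simp: N_def)
      have "nat (s n - int b) \<notin> A"
      proof
        assume "nat (s n - int b) \<in> A"
        then have "nat (s n - int b) + b \<in> A + B" using b by (intro set_plus_intro)
        moreover have "int (nat (s n - int b) + b) = s n" using s b by simp
        ultimately have "s n \<in> int ` (A + B)" by (metis imageI)
        then show False using none that by (auto simp: N_def)
      qed
      then show ?thesis using s b by (simp add: trunc_def g_def)
    qed
    have "card X = card (B \<inter> {1..M})" unfolding X_def by (intro card_image) (auto simp: inj_on_def)
    have "(\<Sum>x\<in>X. (\<Sum>n=a..<a+N. trunc g (2 * M) (x + s n))\<^sup>2) = (\<Sum>x\<in>X. (\<Sum>n=a..<a+N. - \<alpha>)\<^sup>2)"
      using val by (intro sum.cong refl arg_cong[of _ _ "\<lambda>y. y\<^sup>2"]) auto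
    also have "\<dots> = card (B \<inter> {1..M}) * (\<alpha>\<^sup>2 * (real N)\<^sup>2)"
      using \<open>card X = _\<close> by (simp add: power_mult_distrib)
    finally have "card (B \<inter> {1..M}) * (\<alpha>\<^sup>2 * (real N)\<^sup>2) \<le> \<epsilon> * real (2 * M) * (real N)\<^sup>2"
      using bd[of N "2 * M" X a] M by (auto simp: N_def X_def)
    also have "\<dots> = (\<delta> * real M) / 2 * (\<alpha>\<^sup>2 * (real N)\<^sup>2)" by (simp add: \<epsilon>_def)
    finally have "card (B \<inter> {1..M}) \<le> \<delta> * real M / 2"
      using \<open>\<alpha> > 0\<close> by (simp add: N_def)
    moreover have "\<delta> * real M > 0" using M \<open>\<delta> > 0\<close> by simp
    ultimately show False using B by linarith
  qed
qed

subsection \<open>The mean ergodic theorem\<close>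

text \<open>This is the maximum of 0 and the first \<open>n\<close> Birkhoff sums of
  \<open>f\<close> at \<open>x\<close>, computed by recursion through \<open>T x\<close>.\<close>

fun maximal_sum :: "('a \<Rightarrow> 'a) \<Rightarrow> ('a \<Rightarrow> real) \<Rightarrow> nat \<Rightarrow> 'a \<Rightarrow> real" where
  "maximal_sum T f 0 x = 0"
| "maximal_sum T f (Suc n) x = max 0 (f x + maximal_sum T f n (T x))"

lemma maximal_sum_nonneg: "maximal_sum T f n x \<ge> 0"
  by (cases n) auto

lemma maximal_sum_mono_Suc: "maximal_sum T f n x \<le> maximal_sum T f (Suc n) x"
proof (induction n arbitrary: x)
  case 0
  show ?case by (simp add: maximal_sum_nonneg)
next
  case (Suc n)
  show ?case using Suc[of "T x"] by (auto simp: max_def)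
qed

lemma maximal_sum_mono: "m \<le> n \<Longrightarrow> maximal_sum T f m x \<le> maximal_sum T f n x"
  by (rule lift_Suc_mono_le[of "\<lambda>n. maximal_sum T f n x"]) (rule maximal_sum_mono_Suc)

lemma birkhoff_sum_Suc: "(\<Sum>k<Suc n. f ((T ^^ k) x)) = f x + (\<Sum>k<n. f ((T ^^ k) (T x)))"
  by (simp only: sum.lessThan_Suc_shift funpow_swap1 funpow.simps o_apply id_apply funpow_Suc_right)

lemma birkhoff_sum_le_maximal_sum: "(\<Sum>k<n. f ((T ^^ k) x)) \<le> maximal_sum T f n x"
proof (induction n arbitrary: x)
  case (Suc n)
  have "(\<Sum>k<Suc n. f ((T ^^ k) x)) \<le> f x + maximal_sum T f n (T x)"
    unfolding birkhoff_sum_Suc using Suc[of "T x"] by simp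
  then show ?case by simp
qed simp

text \<open>An abstract probability space, so that the ergodic theorem applies to every power of the
  shift.\<close>

locale ergodic_map = prob_space M for M :: "'a measure" +
  fixes T :: "'a \<Rightarrow> 'a"
  assumes measurable_T [measurable]: "T \<in> measurable M M"
    and distr_T: "distr M M T = M"
    and ergodic: "\<And>B. B \<in> sets M \<Longrightarrow> T -` B \<inter> space M = B \<Longrightarrow> prob B = 0 \<or> prob B = 1"
begin

lemma measurable_funpow [measurable]: "T ^^ n \<in> measurable M M"
  by (induction n) (auto simp: id_def)

lemma integral_T:
  assumes "f \<in> borel_measurable M"
  shows "(\<integral>x. f (T x) \<partial>M) = (\<integral>x. f x \<partial>M :: real)"
  using integral_distr[OF measurable_T assms] by (simp add: distr_T)

lemma measurable_maximal_sum [measurable]: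
  "f \<in> borel_measurable M \<Longrightarrow> maximal_sum T f n \<in> borel_measurable M"
proof (induction n)
  case 0
  have "maximal_sum T f 0 = (\<lambda>x. 0)" by (rule ext) simp
  then show ?case by simp
next
  case (Suc n)
  note [measurable] = Suc.IH[OF Suc.prems] Suc.prems
  have "(\<lambda>x. max 0 (f x + maximal_sum T f n (T x))) \<in> borel_measurable M" by measurable
  moreover have "maximal_sum T f (Suc n) = (\<lambda>x. max 0 (f x + maximal_sum T f n (T x)))" by (rule ext) simp
  ultimately show ?case by simp
qed

lemma integrable_bounded:
  assumes "f \<in> borel_measurable M" and "\<And>x. \<bar>f x\<bar> \<le> c"
  shows "integrable M (f :: 'a \<Rightarrow> real)"
  using assms by (intro integrable_const_bound[of _ c]) auto

lemma maximal_sum_bounded: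
  assumes "\<And>x. \<bar>f x\<bar> \<le> c"
  shows "\<bar>maximal_sum T f n x\<bar> \<le> n * c"
proof (induction n arbitrary: x)
  case (Suc n)
  have "0 \<le> c" using assms[of x] by simp
  then show ?case using Suc[of "T x"] assms[of x] by (simp add: algebra_simps abs_le_iff max_def)
qed simp

text \<open>Garsia's argument.\<close>
lemma maximal_ergodic:
  assumes f [measurable]: "f \<in> borel_measurable M" and bd: "\<And>x. \<bar>f x\<bar> \<le> c"
  shows "0 \<le> (\<integral>x. indicator {x\<in>space M. maximal_sum T f (Suc n) x > 0} x * f x \<partial>M)"
proof -
  let ?m = "maximal_sum T f"
  have int: "integrable M (?m n)" for n
    by (rule integrable_bounded[of _ "n * c"]) (auto intro: maximal_sum_bounded bd)
  have intT: "integrable M (\<lambda>x. ?m n (T x))"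
    by (rule integrable_bounded[of _ "n * c"]) (auto intro: maximal_sum_bounded bd)
  have "0 \<le> (\<integral>x. ?m (Suc n) x \<partial>M) - (\<integral>x. ?m n x \<partial>M)"
    using integral_mono[OF int int, of n "Suc n"] maximal_sum_mono_Suc[of T f n]
    by (simp del: maximal_sum.simps)
  also have "\<dots> = (\<integral>x. ?m (Suc n) x - ?m n (T x) \<partial>M)"
    using int intT by (simp add: integral_T del: maximal_sum.simps)
  also have "\<dots> \<le> (\<integral>x. indicator {x\<in>space M. ?m (Suc n) x > 0} x * f x \<partial>M)"
  proof (rule integral_mono)
    show "integrable M (\<lambda>x. ?m (Suc n) x - ?m n (T x))" using int intT by (simp del: maximal_sum.simps)
    have c0: "c \<ge> 0" using bd[of undefined] by (meson abs_ge_zero order_trans)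
    show "integrable M (\<lambda>x. indicator {x\<in>space M. ?m (Suc n) x > 0} x * f x)"
      by (rule integrable_bounded[of _ c]) (use bd c0 in \<open>auto split: split_indicator\<close>)
    \<comment> \<open>Where the maximal sum is positive it equals \<open>f x + ?m n (T x)\<close>;
      elsewhere it is 0, which is at most \<open>?m n (T x)\<close>.\<close>
    fix x assume "x \<in> space M"
    then show "?m (Suc n) x - ?m n (T x) \<le> indicator {x\<in>space M. ?m (Suc n) x > 0} x * f x"
      using maximal_sum_nonneg[of T f n "T x"] by (auto simp: max_def split: split_indicator)
  qed
  finally show ?thesis .
qed

text \<open>The set where the averages exceed \<open>a\<close> by some fixed margin infinitely often
  is invariant, hence null or of full measure. In the latter case the maximal inequality for
  \<open>f - a\<close> would make the integral of \<open>f\<close> at least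
  \<open>a\<close>.\<close>

lemma AE_birkhoff_average_le:
  fixes f :: "'a \<Rightarrow> real"
  assumes f [measurable]: "f \<in> borel_measurable M" and bd: "\<And>x. \<bar>f x\<bar> \<le> c"
    and a: "(\<integral>x. f x \<partial>M) < a" and "\<epsilon> > 0"
  shows "AE x in M. \<forall>\<^sub>F n in sequentially. (\<Sum>k<n. f ((T ^^ k) x)) \<le> (a + \<epsilon>) * n"
proof -
  let ?S = "\<lambda>n x. \<Sum>k<n. f ((T ^^ k) x)"
  \<comment> \<open>The slack \<open>1 / Suc i\<close> absorbs the term by which the sums at \<open>x\<close> and \<open>T x\<close> differ, so \<open>E\<close> is
    strictly invariant.\<close>
  define E where "E = {x\<in>space M. \<exists>i::nat. \<forall>N. \<exists>n\<ge>N. ?S n x > (a + 1 / Suc i) * real n}"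
  have meas [measurable]: "?S n \<in> borel_measurable M" for n by measurable
  have E [measurable]: "E \<in> sets M" unfolding E_def by measurable
  have E_cong: "(\<exists>i::nat. \<forall>N. \<exists>n\<ge>N. ?S n (T x) > (a + 1 / Suc i) * real n)
      \<longleftrightarrow> (\<exists>i::nat. \<forall>N. \<exists>n\<ge>N. ?S n x > (a + 1 / Suc i) * real n)" for x
  proof
    assume "\<exists>i::nat. \<forall>N. \<exists>n\<ge>N. ?S n (T x) > (a + 1 / Suc i) * real n"
    then obtain i :: nat where i: "\<And>N. \<exists>n\<ge>N. ?S n (T x) > (a + 1 / Suc i) * real n" by blast
    \<comment> \<open>The gap between consecutive slacks: once \<open>n \<ge> K\<close>, the amount
      \<open>b * n\<close> outweighs the bounded cost of one extra step of the orbit.\<close>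
    define b where "b = 1 / real (Suc i) - 1 / real (Suc (Suc i))"
    have "b > 0" by (simp add: b_def field_simps add_pos_nonneg)
    obtain K :: nat where K: "K > (\<bar>a\<bar> + 1 + c) / b" using reals_Archimedean2 by blast
    have "\<exists>n\<ge>N. ?S n x > (a + 1 / Suc (Suc i)) * real n" for N
    proof -
      obtain n where n: "n \<ge> max N K" "?S n (T x) > (a + 1 / Suc i) * real n" using i by blast
      have "b * real n \<ge> b * K" using n \<open>b > 0\<close> by simp
      moreover have "b * K > \<bar>a\<bar> + 1 + c" using K \<open>b > 0\<close> by (simp add: field_simps)
      ultimately have "b * real n > \<bar>a\<bar> + 1 + c" by linarith
      moreover have "(a + 1 / Suc i) * real n = (a + 1 / Suc (Suc i)) * real n + b * n"
        by (simp add: b_def algebra_simps)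
      moreover have "(a + 1 / Suc (Suc i)) * real (Suc n) = (a + 1 / Suc (Suc i)) * real n + (a + 1 / Suc (Suc i))"
        by (simp only: of_nat_Suc[of n] distrib_left mult_1_right add.commute)
      moreover have "1 / Suc (Suc i) \<le> (1::real)" by simp
      ultimately have "f x + ?S n (T x) > (a + 1 / Suc (Suc i)) * real (Suc n)"
        using n(2) bd[of x] by linarith
      then show ?thesis using n(1) by (intro exI[of _ "Suc n"]) (simp only: birkhoff_sum_Suc, simp)
    qed
    then show "\<exists>i::nat. \<forall>N. \<exists>n\<ge>N. ?S n x > (a + 1 / Suc i) * real n" by blast
  next
    assume "\<exists>i::nat. \<forall>N. \<exists>n\<ge>N. ?S n x > (a + 1 / Suc i) * real n"
    then obtain i :: nat where i: "\<And>N. \<exists>n\<ge>N. ?S n x > (a + 1 / Suc i) * real n" by blast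
    define b where "b = 1 / real (Suc i) - 1 / real (Suc (Suc i))"
    have "b > 0" by (simp add: b_def field_simps add_pos_nonneg)
    obtain K :: nat where K: "K > (\<bar>a\<bar> + 1 + c) / b" using reals_Archimedean2 by blast
    have "\<exists>n\<ge>N. ?S n (T x) > (a + 1 / Suc (Suc i)) * real n" for N
    proof -
      \<comment> \<open>The \<open>Suc\<close> leaves room for dropping one step of the orbit: the
        remaining \<open>n\<close> is still at least \<open>max N K\<close>.\<close>
      obtain n' where n': "n' \<ge> Suc (max N K)" "?S n' x > (a + 1 / Suc i) * real n'" using i by blast
      then obtain n where n: "n' = Suc n" by (cases n') auto
      have "b * real n \<ge> b * K" using n n' \<open>b > 0\<close> by simp
      moreover have "b * K > \<bar>a\<bar> + 1 + c" using K \<open>b > 0\<close> by (simp add: field_simps)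
      ultimately have "b * real n > \<bar>a\<bar> + 1 + c" by linarith
      moreover have "(a + 1 / Suc i) * real n' = (a + 1 / Suc (Suc i)) * real n + b * n + (a + 1 / Suc i)"
        by (simp add: b_def n algebra_simps add_divide_distrib)
      moreover have "1 / Suc i > (0::real)" by simp
      moreover have "?S n' x = f x + ?S n (T x)" unfolding n by (rule birkhoff_sum_Suc)
      ultimately have "?S n (T x) > (a + 1 / Suc (Suc i)) * real n"
        using n'(2) bd[of x] by linarith
      then show ?thesis using n n' by (intro exI[of _ n]) auto
    qed
    then show "\<exists>i::nat. \<forall>N. \<exists>n\<ge>N. ?S n (T x) > (a + 1 / Suc i) * real n" by blast
  qed
  have "x \<in> T -` E \<inter> space M \<longleftrightarrow> x \<in> E" for x
    using measurable_space[OF measurable_T, of x]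
    unfolding E_def vimage_eq Int_iff mem_Collect_eq E_cong by blast
  then have "T -` E \<inter> space M = E" by blast
  then consider "prob E = 0" | "prob E = 1" using ergodic[OF E] by blast
  then have "prob E = 0"
  proof cases
    case 2
    define g where "g x = f x - a" for x
    have [measurable]: "g \<in> borel_measurable M" unfolding g_def by measurable
    have g_bd: "\<bar>g x\<bar> \<le> c + \<bar>a\<bar>" for x using bd[of x] by (simp add: g_def)
    \<comment> \<open>Almost every point has a positive Birkhoff sum of \<open>g\<close>, so the
      indicator is eventually 1 and the maximal inequality passes to the integral of
      \<open>g\<close> in the limit.\<close>
    have "AE x in M. (\<lambda>n. indicator {x\<in>space M. maximal_sum T g (Suc n) x > 0} x * g x) \<longlonglongrightarrow> g x"
      using AE_prob_1[OF 2]
    proof eventually_elim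
      case (elim x)
      then obtain i :: nat where "\<And>N. \<exists>n\<ge>N. ?S n x > (a + 1 / Suc i) * real n" by (auto simp: E_def)
      then obtain n where n: "n \<ge> 1" "?S n x > (a + 1 / Suc i) * real n" by blast
      have "(a + 1 / Suc i) * real n \<ge> a * real n" by (intro mult_right_mono) auto
      then have "?S n x > a * real n" using n(2) by linarith
      moreover have "(\<Sum>k<n. g ((T ^^ k) x)) = ?S n x - a * real n"
        by (simp add: g_def sum_subtractf)
      ultimately have "maximal_sum T g n x > 0"
        using birkhoff_sum_le_maximal_sum[of g T x n] by linarith
      then have "maximal_sum T g (Suc m) x > 0" if "m \<ge> n" for m
        using maximal_sum_mono[of n "Suc m" T g x] that by linarith
      then have "\<forall>\<^sub>F m in sequentially. indicator {x\<in>space M. maximal_sum T g (Suc m) x > 0} x * g x = g x"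
        using elim E_def by (intro eventually_sequentiallyI[of n]) (auto simp del: maximal_sum.simps)
      then show ?case by (rule tendsto_eventually)
    qed
    then have "(\<lambda>n. \<integral>x. indicator {x\<in>space M. maximal_sum T g (Suc n) x > 0} x * g x \<partial>M) \<longlonglongrightarrow> (\<integral>x. g x \<partial>M)"
    proof (rule integral_dominated_convergence[where w = "\<lambda>_. c + \<bar>a\<bar>", rotated 3])
      fix n show "AE x in M. norm (indicator {x\<in>space M. maximal_sum T g (Suc n) x > 0} x * g x) \<le> c + \<bar>a\<bar>"
        using g_bd by (auto split: split_indicator intro: order_trans[OF abs_ge_zero] simp del: maximal_sum.simps)
    qed (auto simp del: maximal_sum.simps)
    then have "0 \<le> (\<integral>x. g x \<partial>M)"
      by (rule tendsto_lowerbound) (auto simp del: maximal_sum.simps intro!: always_eventually maximal_ergodic[of g] g_bd)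
    also have "(\<integral>x. g x \<partial>M) = (\<integral>x. f x \<partial>M) - a"
      unfolding g_def using integrable_bounded[OF f bd] by (simp add: prob_space)
    finally show ?thesis using a by simp
  qed
  then have "AE x in M. x \<notin> E" using E by (simp add: AE_iff_measurable emeasure_eq_measure prob_eq_0)
  then show ?thesis using AE_space
  proof eventually_elim
    case (elim x)
    obtain i where i: "1 / real (Suc i) < \<epsilon>" using nat_approx_posE[OF \<open>\<epsilon> > 0\<close>] by metis
    from elim obtain N where "\<And>n. n \<ge> N \<Longrightarrow> ?S n x \<le> (a + 1 / Suc i) * real n"
      unfolding E_def by (auto simp: not_less)
    moreover have "(a + 1 / Suc i) * real n \<le> (a + \<epsilon>) * real n" for n
      using i by (intro mult_right_mono) auto
    ultimately show ?case by (meson eventually_sequentiallyI order_trans)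
  qed
qed

text \<open>The one-sided bound is applied to \<open>f\<close> and to \<open>- f\<close>, with
  margin and slack both \<open>1 / Suc i\<close>, for all of the countably many \<open>i\<close> at
  once.\<close>

lemma AE_birkhoff_average_tendsto:
  fixes f :: "'a \<Rightarrow> real"
  assumes f [measurable]: "f \<in> borel_measurable M" and bd: "\<And>x. \<bar>f x\<bar> \<le> c"
  shows "AE x in M. (\<lambda>n. (\<Sum>k<n. f ((T ^^ k) x)) / n) \<longlonglongrightarrow> (\<integral>x. f x \<partial>M)"
proof -
  let ?I = "\<integral>x. f x \<partial>M"
  have "AE x in M. \<forall>i. \<forall>\<^sub>F n in sequentially. (\<Sum>k<n. f ((T ^^ k) x)) \<le> (?I + 1 / Suc i + 1 / Suc i) * n"
    unfolding AE_all_countable by (intro allI AE_birkhoff_average_le[OF f bd]) auto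
  moreover have "AE x in M. \<forall>i. \<forall>\<^sub>F n in sequentially. (\<Sum>k<n. - f ((T ^^ k) x)) \<le> (- ?I + 1 / Suc i + 1 / Suc i) * n"
    unfolding AE_all_countable
    by (intro allI AE_birkhoff_average_le[of "\<lambda>x. - f x" c]) (use bd in auto)
  ultimately show ?thesis
  proof eventually_elim
    case (elim x)
    show ?case
    proof (rule tendstoI)
      fix e :: real assume "e > 0"
      then obtain i where i: "1 / real (Suc i) < e / 2" using nat_approx_posE[of "e / 2"] by auto
      have "\<forall>\<^sub>F n in sequentially. (\<Sum>k<n. f ((T ^^ k) x)) \<le> (?I + 1 / Suc i + 1 / Suc i) * n"
        "\<forall>\<^sub>F n in sequentially. (\<Sum>k<n. - f ((T ^^ k) x)) \<le> (- ?I + 1 / Suc i + 1 / Suc i) * n"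
        using elim by blast+
      then show "\<forall>\<^sub>F n in sequentially. dist ((\<Sum>k<n. f ((T ^^ k) x)) / n) ?I < e"
        using eventually_gt_at_top[of 0]
      proof eventually_elim
        case (elim n)
        then have "(\<Sum>k<n. f ((T ^^ k) x)) / n \<le> ?I + 1 / Suc i + 1 / Suc i"
          "- ((\<Sum>k<n. f ((T ^^ k) x)) / n) \<le> - ?I + 1 / Suc i + 1 / Suc i"
          by (simp_all add: sum_negf pos_divide_le_eq minus_divide_left del: divide_minus_left)
        then show ?case using i unfolding dist_real_def by linarith
      qed
    qed
  qed
qed

text \<open>Dominated convergence turns the pointwise limit into one in mean square, since the
  averages of a bounded function have a constant majorant.\<close>

lemma mean_ergodic:
  fixes f :: "'a \<Rightarrow> real"
  assumes f [measurable]: "f \<in> borel_measurable M" and bd: "\<And>x. \<bar>f x\<bar> \<le> c"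
  shows "(\<lambda>n. \<integral>x. ((\<Sum>k<n. f ((T ^^ k) x)) / n - (\<integral>x. f x \<partial>M))\<^sup>2 \<partial>M) \<longlonglongrightarrow> 0"
proof -
  let ?I = "\<integral>x. f x \<partial>M"
  have c: "c \<ge> 0" using bd[of undefined] by (meson abs_ge_zero order_trans)
  have "(\<lambda>n. \<integral>x. ((\<Sum>k<n. f ((T ^^ k) x)) / n - ?I)\<^sup>2 \<partial>M) \<longlonglongrightarrow> (\<integral>x. 0 \<partial>M)"
  proof (rule integral_dominated_convergence[where w = "\<lambda>_. (c + \<bar>?I\<bar>)\<^sup>2"])
    show "AE x in M. (\<lambda>n. ((\<Sum>k<n. f ((T ^^ k) x)) / n - ?I)\<^sup>2) \<longlonglongrightarrow> 0"
      using AE_birkhoff_average_tendsto[OF f bd]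
    proof eventually_elim
      case (elim x)
      show ?case using tendsto_power[OF LIM_zero[OF elim], of 2] by simp
    qed
    fix n
    show "AE x in M. norm (((\<Sum>k<n. f ((T ^^ k) x)) / n - ?I)\<^sup>2) \<le> (c + \<bar>?I\<bar>)\<^sup>2"
    proof (rule AE_I2)
      fix x
      have "\<bar>\<Sum>k<n. f ((T ^^ k) x)\<bar> \<le> (\<Sum>k<n. c)"
        by (rule order_trans[OF sum_abs sum_mono]) (rule bd)
      then have "\<bar>(\<Sum>k<n. f ((T ^^ k) x)) / n\<bar> \<le> c"
        using c by (cases "n = 0") (auto simp: abs_divide pos_divide_le_eq mult.commute)
      then have "\<bar>(\<Sum>k<n. f ((T ^^ k) x)) / n - ?I\<bar> \<le> c + \<bar>?I\<bar>" by linarith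
      then show "norm (((\<Sum>k<n. f ((T ^^ k) x)) / n - ?I)\<^sup>2) \<le> (c + \<bar>?I\<bar>)\<^sup>2"
        using power_mono[of "\<bar>(\<Sum>k<n. f ((T ^^ k) x)) / n - ?I\<bar>" "c + \<bar>?I\<bar>" 2] by simp
    qed
  qed auto
  then show ?thesis by simp
qed

end

subsection \<open>TE sets and sumsets\<close>

text \<open>Continuity on \<open>X\<close> gives measurability for the Borel sets of
  \<open>X\<close>, and preservation of the measures of sets becomes an identity of image
  measures.\<close>

lemma ergodic_system_ergodic_map:
  fixes \<mu> :: "'a::topological_space measure"
  assumes "ergodic_system X \<mu> T"
  shows "ergodic_map \<mu> T"
proof -
  from assms have mps: "measure_preserving_system X \<mu> T"
    and erg: "\<And>B. B \<in> sets \<mu> \<Longrightarrow> T -` B \<inter> X = B \<Longrightarrow> measure \<mu> B = 0 \<or> measure \<mu> B = 1"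
    by (auto simp: ergodic_system_def)
  from mps interpret prob_space \<mu> by (simp add: measure_preserving_system_def)
  have X: "space \<mu> = X" "sets \<mu> = sets (restrict_space borel X)" "continuous_on X T" "T \<in> X \<rightarrow> X"
    and pres: "\<And>B. B \<in> sets \<mu> \<Longrightarrow> prob (T -` B \<inter> X) = prob B"
    using mps by (auto simp: measure_preserving_system_def)
  have "T \<in> measurable (restrict_space borel X) (restrict_space borel X)"
    using X by (intro measurable_restrict_space2 borel_measurable_continuous_on_restrict)
      (auto simp: space_restrict_space)
  then have T: "T \<in> measurable \<mu> \<mu>" by (simp add: measurable_cong_sets[OF X(2) X(2)])
  show ?thesis
  proof
    show "T \<in> measurable \<mu> \<mu>" by (rule T)
    show "distr \<mu> \<mu> T = \<mu>"
      by (rule measure_eqI) (auto simp: emeasure_distr T emeasure_eq_measure X(1) pres)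
  qed (use erg X(1) in auto)
qed

section \<open>Transfer to the generic point of a TE set\<close>

lemma funpow_shift: "(shift ^^ n) \<omega> = (\<lambda>k. \<omega> (k + n))"
  by (induction n arbitrary: \<omega>) (auto simp: shift_def fun_eq_iff)

lemma continuous_on_coordinate: "continuous_on X (\<lambda>\<omega> :: nat \<Rightarrow> bool. of_bool (\<omega> k) :: real)"
proof -
  have "continuous_on UNIV (of_bool :: bool \<Rightarrow> real)"
    by (simp add: continuous_on_open_vimage open_discrete)
  then show ?thesis
    by (rule continuous_on_compose2[of UNIV]) (auto intro: continuous_on_product_coordinates continuous_on_subset)
qed

text \<open>Total ergodicity makes the \<open>t\<close>-th power of the shift ergodic, so for some
  \<open>H\<close> its averages over \<open>H\<close> steps have small variance. That variance is
  the integral of a continuous function, and genericity under the shift itself transfers the bound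
  to the orbit of \<open>\<xi>\<close>, that is, to translates of \<open>A\<close>.\<close>

lemma TE_set_averages:
  assumes "TE_set A"
  obtains \<alpha> where "\<alpha> > 0" "\<alpha> \<le> 1"
    "\<And>t \<eta>. t \<ge> 1 \<Longrightarrow> \<eta> > 0 \<Longrightarrow> \<exists>H\<ge>1. \<exists>L0. \<forall>L\<ge>L0.
      (\<Sum>y=1..int L. (\<Sum>j<H. if y + t * int j \<ge> 1 then indicator A (nat (y + t * int j)) - \<alpha> else 0)\<^sup>2)
        \<le> \<eta> * (real H)\<^sup>2 * real L"
proof -
  define \<xi> where "\<xi> = indicator_seq A"
  define X where "X = orbit_closure \<xi>"
  define \<phi> where "\<phi> \<omega> = (of_bool (\<omega> 0) :: real)" for \<omega> :: "nat \<Rightarrow> bool"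
  obtain \<mu> d where mps: "measure_preserving_system X \<mu> shift" and gen: "generic_point X \<mu> shift \<xi>"
    and te: "totally_ergodic_system X \<mu> shift" and "d > 0" and d: "has_density A d"
    using assms unfolding TE_set_def X_def \<xi>_def by auto
  have generic: "(\<lambda>N. (\<Sum>n<N. F ((shift ^^ n) \<xi>)) / real N) \<longlonglongrightarrow> (\<integral>x. F x \<partial>\<mu>)"
    if "continuous_on X F" for F :: "(nat \<Rightarrow> bool) \<Rightarrow> real"
    using gen that by (simp add: generic_point_def)
  have \<phi>_shift: "\<phi> ((shift ^^ m) \<omega>) = of_bool (\<omega> m)" for m \<omega>
    by (simp add: \<phi>_def funpow_shift)
  have cont: "continuous_on X (\<lambda>\<omega>. \<phi> ((shift ^^ m) \<omega>))" for m
    unfolding \<phi>_shift by (rule continuous_on_coordinate)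
  \<comment> \<open>Orbit averages of the first coordinate at \<open>\<xi>\<close> are the density
    averages of \<open>A\<close>; genericity thus identifies the integral of \<open>\<phi>\<close>
    with \<open>d\<close>.\<close>
  have "(\<Sum>n<N. \<phi> ((shift ^^ n) \<xi>)) / real N = density_avg A N" for N
  proof -
    have "(\<Sum>n<N. \<phi> ((shift ^^ n) \<xi>)) = (\<Sum>n=1..N. indicator A n)"
      by (simp add: \<phi>_shift \<xi>_def indicator_seq_def sum.atLeast1_atMost_eq indicator_def of_bool_def)
    then show ?thesis by (simp add: density_avg_def)
  qed
  then have "density_avg A \<longlonglongrightarrow> (\<integral>x. \<phi> x \<partial>\<mu>)"
    using generic[of \<phi>] cont[of 0] by simp
  then have d_eq: "(\<integral>x. \<phi> x \<partial>\<mu>) = d"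
    using d LIMSEQ_unique unfolding has_density_def by blast
  have erg: "ergodic_map \<mu> (shift ^^ k)" if "k \<ge> 1" for k
    using te that by (intro ergodic_system_ergodic_map[of X]) (simp add: totally_ergodic_system_def)
  have meas: "\<phi> \<in> borel_measurable \<mu>"
  proof -
    have "sets \<mu> = sets (restrict_space borel X)" using mps by (simp add: measure_preserving_system_def)
    moreover have "\<phi> \<in> borel_measurable (restrict_space borel X)"
      using cont[of 0] by (intro borel_measurable_continuous_on_restrict) simp
    ultimately show ?thesis using measurable_cong_sets[of \<mu> "restrict_space borel X" borel borel] by blast
  qed
  have "d \<le> 1"
  proof -
    interpret ergodic_map \<mu> "shift ^^ 1" by (rule erg) simp
    have "(\<integral>x. \<phi> x \<partial>\<mu>) \<le> (\<integral>x. 1 \<partial>\<mu>)"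
      by (intro integral_mono integrable_bounded[of _ 1] meas) (auto simp: \<phi>_def)
    then show ?thesis by (simp add: d_eq prob_space)
  qed
  show ?thesis
  proof (rule that[OF \<open>d > 0\<close> \<open>d \<le> 1\<close>])
    fix t :: int and \<eta> :: real assume "t \<ge> 1" "\<eta> > 0"
    define k where "k = nat t"
    have k: "k \<ge> 1" "t = int k" using \<open>t \<ge> 1\<close> by (auto simp: k_def)
    let ?T = "shift ^^ k"
    interpret ergodic_map \<mu> ?T by (rule erg) (rule k)
    \<comment> \<open>The squared deviation depends on finitely many coordinates only, hence is
      continuous and open to genericity.\<close>
    define F where "F H \<omega> = ((\<Sum>j<H. \<phi> ((?T ^^ j) \<omega>)) / real H - d)\<^sup>2" for H \<omega>
    have "(\<lambda>H. \<integral>\<omega>. F H \<omega> \<partial>\<mu>) \<longlonglongrightarrow> 0"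
      using mean_ergodic[OF meas, of 1] unfolding F_def d_eq by (simp add: \<phi>_def)
    then have "\<forall>\<^sub>F H in sequentially. (\<integral>\<omega>. F H \<omega> \<partial>\<mu>) < \<eta>"
      using \<open>\<eta> > 0\<close> by (simp add: order_tendsto_iff)
    then obtain H where H: "H \<ge> 1" "(\<integral>\<omega>. F H \<omega> \<partial>\<mu>) < \<eta>"
      using eventually_happens'[OF sequentially_bot eventually_conj[OF eventually_ge_at_top[of 1]]] by blast
    have "continuous_on X (F H)"
      unfolding F_def funpow_mult using H by (intro continuous_intros cont) auto
    then have "\<forall>\<^sub>F L in sequentially. (\<Sum>n<L. F H ((shift ^^ n) \<xi>)) / real L < \<eta>"
      by (rule order_tendstoD(2)[OF generic H(2)])
    then obtain L0 where L0: "\<And>L. L \<ge> L0 \<Longrightarrow> (\<Sum>n<L. F H ((shift ^^ n) \<xi>)) / real L < \<eta>"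
      by (auto simp: eventually_sequentially)
    show "\<exists>H\<ge>1. \<exists>L0. \<forall>L\<ge>L0.
      (\<Sum>y=1..int L. (\<Sum>j<H. if y + t * int j \<ge> 1 then indicator A (nat (y + t * int j)) - d else 0)\<^sup>2)
        \<le> \<eta> * (real H)\<^sup>2 * real L"
    proof (intro exI conjI allI impI)
      show "H \<ge> 1" by (rule H)
      fix L assume "L \<ge> L0"
      let ?g = "\<lambda>x. if x \<ge> 1 then indicator A (nat x) - d else 0"
      \<comment> \<open>The integer \<open>y = n + 1\<close> sits at position \<open>n\<close> of
        \<open>\<xi>\<close>.\<close>
      have "(\<Sum>y=1..int L. G y) = (\<Sum>n<L. G (int (Suc n)))" for G :: "int \<Rightarrow> real"
        by (rule sum.reindex_bij_witness[of _ "\<lambda>n. int (Suc n)" "\<lambda>y. nat (y - 1)"]) auto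
      then have "(\<Sum>y=1..int L. (\<Sum>j<H. ?g (y + t * int j))\<^sup>2) = (\<Sum>n<L. (\<Sum>j<H. ?g (int (Suc n) + t * int j))\<^sup>2)" .
      also have "\<dots> = (\<Sum>n<L. (real H)\<^sup>2 * F H ((shift ^^ n) \<xi>))"
      proof (intro sum.cong refl)
        fix n
        have "(?T ^^ j) ((shift ^^ n) \<xi>) = (shift ^^ (n + k * j)) \<xi>" for j
          by (simp add: funpow_mult funpow_shift algebra_simps)
        moreover have "?g (int (Suc n) + t * int j) = \<phi> ((shift ^^ (n + k * j)) \<xi>) - d" for j
        proof -
          have "int (Suc n) + t * int j = int (Suc (n + k * j))" by (simp add: k)
          then show ?thesis
            by (simp add: \<phi>_shift \<xi>_def indicator_seq_def indicator_def of_bool_def del: of_nat_Suc)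
        qed
        ultimately have "(\<Sum>j<H. ?g (int (Suc n) + t * int j)) = (\<Sum>j<H. \<phi> ((?T ^^ j) ((shift ^^ n) \<xi>)) - d)"
          by simp
        also have "\<dots> = real H * ((\<Sum>j<H. \<phi> ((?T ^^ j) ((shift ^^ n) \<xi>))) / real H - d)"
          using H(1) by (simp add: sum_subtractf algebra_simps)
        finally show "(\<Sum>j<H. ?g (int (Suc n) + t * int j))\<^sup>2 = (real H)\<^sup>2 * F H ((shift ^^ n) \<xi>)"
          by (simp only: F_def power_mult_distrib)
      qed
      also have "\<dots> = (real H)\<^sup>2 * (\<Sum>n<L. F H ((shift ^^ n) \<xi>))" by (simp add: sum_distrib_left)
      also have "\<dots> \<le> (real H)\<^sup>2 * (\<eta> * L)"
      proof (rule mult_left_mono)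
        show "(\<Sum>n<L. F H ((shift ^^ n) \<xi>)) \<le> \<eta> * L"
          using L0[OF \<open>L \<ge> L0\<close>] by (cases "L = 0") (auto simp: pos_divide_less_eq)
      qed simp
      finally show "(\<Sum>y=1..int L. (\<Sum>j<H. ?g (y + t * int j))\<^sup>2) \<le> \<eta> * (real H)\<^sup>2 * real L"
        by (simp add: algebra_simps)
    qed
  qed
qed

section \<open>Windows of polynomial values and bounded gaps\<close>

lemma density_avg_eq_card: "density_avg S N = card (S \<inter> {1..N}) / N"
  by (simp add: density_avg_def indicator_def sum.If_cases Int_commute)

lemma poly_shift_ge:
  fixes p :: "int poly"
  assumes "\<And>n. n \<ge> m0 \<Longrightarrow> poly p (int n) < poly p (int (Suc n))" and "m \<ge> m0"
  shows "poly p (int m) + int k \<le> poly p (int (m + k))"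
proof (induction k)
  case (Suc k)
  then show ?case using assms(1)[of "m + k"] assms(2) by simp
qed simp

text \<open>At a crossing \<open>p(m) \<le> M < p(m + 1)\<close> the next \<open>N\<close> values
  exceed \<open>M\<close> by monotonicity and are at most \<open>2 * p(m) \<le> 2 * M\<close> by
  doubling. That \<open>N\<close> depends on neither \<open>m\<close> nor \<open>M\<close> yields
  the bounded gaps.\<close>

lemma poly_window_meets_sumset:
  fixes A B :: "nat set" and p :: "int poly"
  assumes "TE_set A" and "degree p > 0" and "lead_coeff p > 0" and "\<delta> > 0"
  obtains N m0 M0 where
    "\<And>n. n \<ge> m0 \<Longrightarrow> poly p (int n) < poly p (int (Suc n))"
    "\<And>m M. \<lbrakk>m \<ge> m0; M \<ge> M0; poly p (int m) \<le> int M; int M < poly p (int (Suc m));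
      \<delta> * real M \<le> real (card (B \<inter> {1..M}))\<rbrakk> \<Longrightarrow>
      \<exists>n. m < n \<and> n \<le> m + N \<and> poly p (int n) \<in> int ` (A + B)"
proof -
  obtain \<alpha> where "\<alpha> > 0" "\<alpha> \<le> 1" and
    avg: "\<And>t \<eta>. t \<ge> 1 \<Longrightarrow> \<eta> > 0 \<Longrightarrow> \<exists>H\<ge>1. \<exists>L0. \<forall>L\<ge>L0.
      (\<Sum>y=1..int L. (\<Sum>j<H. if y + t * int j \<ge> 1 then indicator A (nat (y + t * int j)) - \<alpha> else 0)\<^sup>2)
        \<le> \<eta> * (real H)\<^sup>2 * real L"
    by (rule TE_set_averages[OF \<open>TE_set A\<close>]) (rule that, blast+)
  define g where "g x = (if x \<ge> 1 then indicator A (nat x) - \<alpha> else 0)" for x :: int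
  have "vanishing g (\<lambda>n. poly p (int n))"
  proof (rule vanishing_poly)
    show "\<bar>g x\<bar> \<le> 1" for x using \<open>\<alpha> > 0\<close> \<open>\<alpha> \<le> 1\<close> by (auto simp: g_def indicator_def)
    show "\<exists>H\<ge>1. \<exists>L0. \<forall>L\<ge>L0. (\<Sum>y=1..int L. (\<Sum>j<H. g (y + t * int j))\<^sup>2) \<le> \<eta> * (real H)\<^sup>2 * real L"
      if "t \<ge> 1" "\<eta> > 0" for t \<eta>
      using avg[OF that] unfolding g_def .
  qed (use assms in auto)
  then obtain N M0 where window: "\<And>M a. \<lbrakk>M \<ge> M0; \<delta> * real M \<le> real (card (B \<inter> {1..M}));
    \<And>n. a \<le> n \<Longrightarrow> n < a + N \<Longrightarrow> int M < poly p (int n) \<and> poly p (int n) \<le> 2 * int M\<rbrakk> \<Longrightarrow>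
    \<exists>n. a \<le> n \<and> n < a + N \<and> poly p (int n) \<in> int ` (A + B)"
    unfolding g_def[abs_def]
    by (rule sumset_meets_window[OF _ \<open>\<alpha> > 0\<close> \<open>\<delta> > 0\<close>, where B = B]) (assumption | rule that, blast+)
  \<comment> \<open>With \<open>N\<close> already fixed, doubling holds simultaneously for the
    finitely many shifts \<open>k \<le> N\<close> from some \<open>m0\<close> on.\<close>
  have "\<forall>\<^sub>F n in sequentially. poly p (int n) < poly p (int (Suc n)) \<and>
      (\<forall>k\<in>{..N}. poly p (int (n + k)) \<le> 2 * poly p (int n))"
    using assms by (intro eventually_conj eventually_poly_less_shift eventually_ball_finite ballI
        eventually_poly_shift_le_double) auto
  then obtain m0 where incr: "\<And>n. n \<ge> m0 \<Longrightarrow> poly p (int n) < poly p (int (Suc n))"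
    and dbl: "\<And>n k. n \<ge> m0 \<Longrightarrow> k \<le> N \<Longrightarrow> poly p (int (n + k)) \<le> 2 * poly p (int n)"
    unfolding eventually_sequentially by blast
  show ?thesis
  proof (rule that[OF incr])
    fix m M assume m: "m \<ge> m0" "poly p (int m) \<le> int M" "int M < poly p (int (Suc m))"
      and M: "M \<ge> M0" "\<delta> * real M \<le> real (card (B \<inter> {1..M}))"
    have "\<exists>n. Suc m \<le> n \<and> n < Suc m + N \<and> poly p (int n) \<in> int ` (A + B)"
    proof (rule window[OF M])
      fix n assume n: "Suc m \<le> n" "n < Suc m + N"
      have "poly p (int (Suc m)) + int (n - Suc m) \<le> poly p (int (Suc m + (n - Suc m)))"
        using m by (intro poly_shift_ge[OF incr]) auto
      moreover have "poly p (int (m + (n - m))) \<le> 2 * poly p (int m)" using m n by (intro dbl) auto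
      ultimately show "int M < poly p (int n) \<and> poly p (int n) \<le> 2 * int M" using m n by auto
    qed
    then show "\<exists>n. m < n \<and> n \<le> m + N \<and> poly p (int n) \<in> int ` (A + B)"
      by (simp only: Suc_le_eq add_Suc less_Suc_eq_le)
  qed
qed

theorem theorem1p1:
  fixes A B :: "nat set" and p :: "int poly"
  assumes "A \<subseteq> {1..}" and "TE_set A"
    and "B \<subseteq> {1..}" and "upper_density B > 0"
    and "degree p > 0" and "lead_coeff p > 0"
  shows "int ` (A + B) \<inter> {poly p (int n) | n. n \<ge> 1} \<noteq> {} \<and>
         ((\<exists>d>0. has_density B d) \<longrightarrow>
            syndetic {n. n \<ge> 1 \<and> poly p (int n) \<in> int ` (A + B)})"
proof (intro conjI impI)
  obtain \<delta>' where "0 < \<delta>'" "\<delta>' < upper_density B" using \<open>upper_density B > 0\<close> dense by blast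
  moreover have "\<delta>' \<noteq> \<infinity>" "\<delta>' \<noteq> - \<infinity>" using calculation by auto
  ultimately obtain \<delta> where \<delta>: "\<delta> > 0" "ereal \<delta> < upper_density B" by (cases \<delta>') auto
  obtain N m0 M0 where incr: "\<And>n. n \<ge> m0 \<Longrightarrow> poly p (int n) < poly p (int (Suc n))"
    and window: "\<And>m M. \<lbrakk>m \<ge> m0; M \<ge> M0; poly p (int m) \<le> int M; int M < poly p (int (Suc m));
      \<delta> * real M \<le> real (card (B \<inter> {1..M}))\<rbrakk> \<Longrightarrow>
      \<exists>n. m < n \<and> n \<le> m + N \<and> poly p (int n) \<in> int ` (A + B)"
    by (rule poly_window_meets_sumset[OF assms(2,5,6) \<open>\<delta> > 0\<close>, where B = B]) (rule that, blast+)
  \<comment> \<open>The limsup exceeds \<open>\<delta>\<close>, so \<open>M\<close> can be taken as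
    large as desired; \<open>M \<ge> p(m0)\<close> ensures a crossing at or after
    \<open>m0\<close>.\<close>
  have "\<exists>M \<ge> max 1 (max M0 (nat (poly p (int m0)))). density_avg B M > \<delta>"
  proof (rule ccontr)
    assume "\<not> ?thesis"
    then have "\<forall>\<^sub>F M in sequentially. ereal (density_avg B M) \<le> \<delta>"
      by (intro eventually_sequentiallyI[of "max 1 (max M0 (nat (poly p (int m0))))"]) (auto simp: not_less)
    then have "upper_density B \<le> \<delta>" unfolding upper_density_def by (rule Limsup_bounded)
    then show False using \<delta> by simp
  qed
  then obtain M where M: "M \<ge> 1" "M \<ge> M0" "poly p (int m0) \<le> int M" "density_avg B M > \<delta>" by auto
  \<comment> \<open>The last \<open>k\<close> before \<open>P\<close> becomes true gives the
    crossing. Since \<open>p\<close> grows by at least 1 per step beyond \<open>m0\<close>, it must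
    pass \<open>M\<close>.\<close>
  define P where "P k \<longleftrightarrow> int M < poly p (int (m0 + k))" for k
  have "P (nat (int M - poly p (int m0)) + 1)"
    using poly_shift_ge[of m0 p m0 "nat (int M - poly p (int m0)) + 1", OF incr] M(3) by (simp add: P_def)
  moreover have "\<not> P 0" using M(3) by (simp add: P_def)
  ultimately obtain k where "\<not> P k" "P (Suc k)" using nat_induct[of "\<lambda>k. \<not> P k"] by blast
  moreover have "\<delta> * real M \<le> real (card (B \<inter> {1..M}))"
    using M(1,4) by (simp add: density_avg_eq_card pos_less_divide_eq)
  ultimately obtain n where "m0 + k < n" "poly p (int n) \<in> int ` (A + B)"
    using window[of "m0 + k" M] M(2) by (auto simp: P_def)
  then have "poly p (int n) \<in> int ` (A + B) \<inter> {poly p (int n) | n. n \<ge> 1}" by auto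
  then show "int ` (A + B) \<inter> {poly p (int n) | n. n \<ge> 1} \<noteq> {}" by blast
next
  assume "\<exists>d>0. has_density B d"
  then obtain d where d_pos: "d > 0" and d: "density_avg B \<longlonglongrightarrow> d" by (auto simp: has_density_def)
  have "d / 2 > 0" using d_pos by simp
  obtain N m0 M0 where incr: "\<And>n. n \<ge> m0 \<Longrightarrow> poly p (int n) < poly p (int (Suc n))"
    and window: "\<And>m M. \<lbrakk>m \<ge> m0; M \<ge> M0; poly p (int m) \<le> int M; int M < poly p (int (Suc m));
      d / 2 * real M \<le> real (card (B \<inter> {1..M}))\<rbrakk> \<Longrightarrow>
      \<exists>n. m < n \<and> n \<le> m + N \<and> poly p (int n) \<in> int ` (A + B)"
    by (rule poly_window_meets_sumset[OF assms(2,5,6) \<open>d / 2 > 0\<close>, where B = B]) (rule that, blast+)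
  have "\<forall>\<^sub>F M in sequentially. density_avg B M > d / 2"
    using d d_pos by (intro order_tendstoD(1)) auto
  \<comment> \<open>A limit makes every large \<open>M\<close> admissible, so a window can be placed
    after any given \<open>n\<close>.\<close>
  then obtain M1 where M1: "\<And>M. M \<ge> M1 \<Longrightarrow> density_avg B M > d / 2"
    by (auto simp: eventually_sequentially)
  \<comment> \<open>The offset is chosen so that \<open>n + r \<ge> m0\<close> and
    \<open>p(n + r)\<close> passes all thresholds, for every \<open>n\<close>; the gaps are then at
    most \<open>r + N\<close>.\<close>
  define r where "r = m0 + nat \<bar>poly p (int m0)\<bar> + max 1 (max M0 M1)"
  show "syndetic {n. n \<ge> 1 \<and> poly p (int n) \<in> int ` (A + B)}"
    unfolding syndetic_def
  proof (intro exI allI impI)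
    fix n :: nat assume "n \<ge> 1"
    define m where "m = n + r"
    \<comment> \<open>Taking \<open>M = p(m)\<close> places the crossing at \<open>m\<close>
      itself.\<close>
    define M where "M = nat (poly p (int m))"
    have "m0 \<le> m" by (simp add: m_def r_def)
    have "poly p (int m0) + int (m - m0) \<le> poly p (int (m0 + (m - m0)))"
      by (rule poly_shift_ge[OF incr]) auto
    moreover have "m0 + (m - m0) = m" using \<open>m0 \<le> m\<close> by simp
    moreover have "int (m - m0) = int n + \<bar>poly p (int m0)\<bar> + int (max 1 (max M0 M1))"
      by (simp add: m_def r_def)
    ultimately have "int (max 1 (max M0 M1)) \<le> poly p (int m)" by (simp only:) linarith
    then have M: "M \<ge> 1" "M \<ge> M0" "M \<ge> M1" "int M = poly p (int m)" by (auto simp: M_def)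
    have "d / 2 * real M \<le> real (card (B \<inter> {1..M}))"
      using M1[OF M(3)] M(1) by (simp add: density_avg_eq_card field_simps)
    then obtain n' where "m < n'" "n' \<le> m + N" "poly p (int n') \<in> int ` (A + B)"
      using window[OF \<open>m0 \<le> m\<close> M(2)] incr[OF \<open>m0 \<le> m\<close>] M(4) by auto
    then show "\<exists>m\<in>{n. n \<ge> 1 \<and> poly p (int n) \<in> int ` (A + B)}. n \<le> m \<and> m \<le> n + (r + N)"
      by (intro bexI[of _ n']) (auto simp: m_def)
  qed
qed

end
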